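(* Let $(\tau_n)_{n\ge 0}$ be the random recursive tree with doubling events at the root, and let $H_n=\max\{|w|: w\in\tau_n\}$ denote the height of $\tau_n$. Almost surely as $n\to\infty$, $$H_n\ \ge\ \frac{1+\mathrm e}{1+\log 2}\cdot\log n+o(\log n).$$
   Context: Trees (Ulam--Harris notation): a tree is a set $\tau$ of finite words over the alphabet $\{1,2,3,\ldots\}$ such that every prefix of a word of $\tau$ (including the empty word $\varnothing$, called the root) is in $\tau$. Elements of $\tau$ are called nodes. For a node $w\in\tau$, $|w|$ denotes its length as a word, called its height. $\log$ is the natural logarithm and $\mathrm e$ its base. The term $o(\log n)$ denotes a random sequence which, divided by $\log n$, tends to $0$ almost surely. The random recursive tree with doubling events $(\tau_n)_{n\ge0}$ is defined by $\tau_0=\{\varnothing\}$ and, for all $n\ge0$, given $\tau_n$ (and the past): pick a node $\nu_n$ uniformly at random among the nodes of $\tau_n$; - if $\nu_n=\varnothing$, set $\tau_{n+1}=\{\varnothing\}\cup\{1w: w\in\tau_n\}\cup\{2w: w\in\tau_n\}$ (a doubling event); - if $\nu_n\ne\varnothing$, set $\tau_{n+1}=\tau_n\cup\{\nu_n j\}$ where $j=\min\{i\ge1:\nu_n i\notin\tau_n\}$. *)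

theory Defs
  imports "HOL-Probability.Probability"
begin

(* Words over {1, 2, 3, ...} are lists of positive naturals. The child w j of a node w
   is w @ [j]; prefixing the letter 1 to a word w is 1 # w. *)
definition ulam_harris_tree :: "nat list set \<Rightarrow> bool" where
  "ulam_harris_tree t \<longleftrightarrow>
     [] \<in> t \<and> (\<forall>w\<in>t. \<forall>j\<in>set w. 1 \<le> j) \<and> (\<forall>u v. u @ v \<in> t \<longrightarrow> u \<in> t)"

definition rrt_step :: "nat list set \<Rightarrow> nat list \<Rightarrow> nat list set" where
  "rrt_step t v =
     (if v = [] then {[]} \<union> (\<lambda>w. 1 # w) ` t \<union> (\<lambda>w. 2 # w) ` t
      else t \<union> {v @ [LEAST i. 1 \<le> i \<and> v @ [i] \<notin> t]})"

definition tree_height :: "nat list set \<Rightarrow> nat" where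
  "tree_height t = Max (length ` t)"

(* \<nu> n is the node picked at step n. The law of \<nu> n given the past is expressed by elementary
   conditional probabilities: the past (\<tau> 0, ..., \<tau> n, \<nu> 0, ..., \<nu> (n - 1)) takes only countably
   many values. The \<tau> n need no separate measurability assumption: by tree_0 and tree_Suc,
   \<tau> n is a function of the discrete random variables \<nu> 0, ..., \<nu> (n - 1).
   That \<nu> n is a node of \<tau> n is only required almost surely, as a consequence of uniform_pick. *)
locale rrt_doubling = prob_space M
  for M :: "'a measure" +
  fixes \<tau> :: "nat \<Rightarrow> 'a \<Rightarrow> nat list set"
    and \<nu> :: "nat \<Rightarrow> 'a \<Rightarrow> nat list"
  assumes pick_measurable: "\<And>n. \<nu> n \<in> measurable M (count_space UNIV)"
    and tree_0: "\<And>\<omega>. \<omega> \<in> space M \<Longrightarrow> \<tau> 0 \<omega> = {[]}"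
    and tree_Suc: "\<And>n \<omega>. \<omega> \<in> space M \<Longrightarrow> \<tau> (Suc n) \<omega> = rrt_step (\<tau> n \<omega>) (\<nu> n \<omega>)"
    and uniform_pick: "\<And>n t v w.
        \<lbrakk> prob {\<omega> \<in> space M. (\<forall>i\<le>n. \<tau> i \<omega> = t i) \<and> (\<forall>i<n. \<nu> i \<omega> = v i)} > 0; w \<in> t n \<rbrakk> \<Longrightarrow>
        \<P>(\<omega> in M. \<nu> n \<omega> = w \<bar> (\<forall>i\<le>n. \<tau> i \<omega> = t i) \<and> (\<forall>i<n. \<nu> i \<omega> = v i))
          = 1 / real (card (t n))"

lemma ulam_harris_treeI:
  assumes "[] \<in> t"
    and "\<And>w j. w \<in> t \<Longrightarrow> j \<in> set w \<Longrightarrow> 1 \<le> j"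
    and "\<And>u w. u @ w \<in> t \<Longrightarrow> u \<in> t"
  shows "ulam_harris_tree t"
  using assms unfolding ulam_harris_tree_def by blast

lemma ulam_harris_treeD:
  assumes "ulam_harris_tree t"
  shows "[] \<in> t"
    and "w \<in> t \<Longrightarrow> j \<in> set w \<Longrightarrow> 1 \<le> j"
    and "u @ w \<in> t \<Longrightarrow> u \<in> t"
  using assms unfolding ulam_harris_tree_def by blast+

lemma ulam_harris_tree_root: "ulam_harris_tree {[]}"
  by (rule ulam_harris_treeI) simp_all

lemma ulam_harris_tree_rrt_step:
  assumes t: "ulam_harris_tree t" and fin: "finite t" and v: "v \<in> t"
  shows "ulam_harris_tree (rrt_step t v)"
proof (cases "v = []")
  case True
  then have mem: "x \<in> rrt_step t v \<longleftrightarrow> x = [] \<or> (\<exists>a w. x = a # w \<and> (a = 1 \<or> a = 2) \<and> w \<in> t)" for x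
    by (auto simp: rrt_step_def)
  show ?thesis
  proof (rule ulam_harris_treeI)
    show "[] \<in> rrt_step t v"
      by (simp add: mem)
    show "1 \<le> j" if "w \<in> rrt_step t v" "j \<in> set w" for w j
    proof (cases w)
      case (Cons a w')
      then have "(a = 1 \<or> a = 2) \<and> w' \<in> t" "j = a \<or> j \<in> set w'"
        using that by (simp_all add: mem)
      then show ?thesis
        using ulam_harris_treeD(2)[OF t] by (metis one_le_numeral order_refl)
    qed (use that in simp)
    show "u \<in> rrt_step t v" if "u @ w \<in> rrt_step t v" for u w
    proof (cases u)
      case (Cons a u')
      then have a: "(a = 1 \<or> a = 2) \<and> u' @ w \<in> t"
        using that by (simp add: mem)
      then have "u' \<in> t"
        using ulam_harris_treeD(3)[OF t] by blast
      then show ?thesis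
        using a Cons by (simp add: mem)
    qed (simp add: mem)
  qed
next
  case False
  define k where "k = (LEAST i. 1 \<le> i \<and> v @ [i] \<notin> t)"
  have "finite ((\<lambda>i. v @ [i]) -` t)"
    using fin by (intro finite_vimageI) (simp_all add: inj_def)
  then have "finite (insert 0 ((\<lambda>i. v @ [i]) -` t))"
    by simp
  then obtain i where "i \<notin> insert 0 ((\<lambda>i. v @ [i]) -` t)"
    using ex_new_if_finite[OF infinite_UNIV_nat] by blast
  then have "1 \<le> i \<and> v @ [i] \<notin> t"
    by simp
  then have k: "1 \<le> k \<and> v @ [k] \<notin> t"
    unfolding k_def by (rule LeastI)
  have mem: "x \<in> rrt_step t v \<longleftrightarrow> x = v @ [k] \<or> x \<in> t" for x
    using False by (simp add: rrt_step_def k_def)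
  show ?thesis
  proof (rule ulam_harris_treeI)
    show "[] \<in> rrt_step t v"
      using ulam_harris_treeD(1)[OF t] by (simp add: mem)
    show "1 \<le> j" if w: "w \<in> rrt_step t v" and j: "j \<in> set w" for w j
    proof (cases "w \<in> t")
      case True
      then show ?thesis
        using ulam_harris_treeD(2)[OF t] j by blast
    next
      case False
      then have "j = k \<or> j \<in> set v"
        using w j by (simp add: mem)
      then show ?thesis
        using ulam_harris_treeD(2)[OF t v] k by blast
    qed
    show "u \<in> rrt_step t v" if uw: "u @ w \<in> rrt_step t v" for u w
    proof (cases "u @ w \<in> t")
      case True
      then show ?thesis
        using ulam_harris_treeD(3)[OF t] mem by blast
    next
      case False
      then have eq: "u @ w = v @ [k]"
        using uw by (simp add: mem)
      show ?thesis
      proof (cases w rule: rev_cases)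
        case Nil
        then show ?thesis using eq by (simp add: mem)
      next
        case (snoc ys y)
        then have "u @ ys = v"
          using eq by (metis append_assoc butlast_snoc)
        then show ?thesis
          using v ulam_harris_treeD(3)[OF t] mem by blast
      qed
    qed
  qed
qed

end

(* Let D be the number of doublings so far, N the size of the tree, and let the clock T be the sum
   of 1/N over the past steps, i.e. the compensator of D. The size satisfies ln N <= T + D ln 2
   surely, and N > n, so ln n <= T + D ln 2.

   Measure heights relative to D. The number A j of non-root nodes at height D + j never decreases,
   and it increases when a node at relative height j - 1 is picked, which happens at rate A (j - 1)
   per unit of clock. As long as the counts involved exceed a power of log n, exponential
   supermartingale bounds make the counts grow at least like the solution of the Euler scheme
   x (r + 1) (j + 1) = x r (j + 1) + q * x r j, that is like q^j * (r choose j); since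
   T^m / m! > 1 holds for m up to almost e * T, this pushes the front to relative height
   (e - o(1)) T. A power of log n many nodes at relative height 0 is provided by the first
   doublings. Hence the height is at least D + (e - o(1)) T.

   Finally D <= (1 + o(1)) T, and because e ln 2 > 1 the quotient (D + e T) / (T + D ln 2) is
   decreasing in D, so the worst case is D = T, which gives (1 + e) / (1 + ln 2). All
   probabilistic estimates are made for n = 2^k only, where the error bounds are summable. *)
theory Submission
  imports Defs "HOL-Library.Discrete_Functions"
begin

subsection \<open>Trees as functions of the list of picks\<close>

(* A history lists the picks with the most recent one first. *)
fun hist_tree :: "nat list list \<Rightarrow> nat list set" where
  "hist_tree [] = {[]}"
| "hist_tree (v # h) = rrt_step (hist_tree h) v"

fun doublings :: "nat list list \<Rightarrow> nat" where
  "doublings [] = 0"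
| "doublings (v # h) = doublings h + (if v = [] then 1 else 0)"

fun clock :: "nat list list \<Rightarrow> real" where
  "clock [] = 0"
| "clock (v # h) = clock h + 1 / real (card (hist_tree h))"

text \<open>A doubling turns a node into two nodes that are one letter longer and raises
  \<open>doublings\<close> by 1, so relative heights are kept. The root is left out because picking
  it doubles the tree instead of adding a child.\<close>

definition level :: "nat list list \<Rightarrow> nat \<Rightarrow> nat list set" where
  "level h j = {w \<in> hist_tree h. w \<noteq> [] \<and> length w = doublings h + j}"

text \<open>The index \<open>j\<close> is the level picked from: this compensates the children added
  to level \<open>Suc j\<close> and ignores the gains from doublings.\<close>

fun compensator :: "nat \<Rightarrow> nat list list \<Rightarrow> real" where
  "compensator j [] = 0"
| "compensator j (v # h) = compensator j h + real (card (level h j)) / real (card (hist_tree h))"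

lemma finite_rrt_step: "finite t \<Longrightarrow> finite (rrt_step t v)"
  by (simp add: rrt_step_def)

lemma finite_hist_tree [simp]: "finite (hist_tree h)"
  by (induction h) (simp_all add: finite_rrt_step)

lemma root_in_hist_tree [simp]: "[] \<in> hist_tree h"
  by (induction h) (auto simp: rrt_step_def)

lemma hist_tree_nonempty [simp]: "hist_tree h \<noteq> {}"
  using root_in_hist_tree by blast

lemma finite_level [simp]: "finite (level h j)"
  by (simp add: level_def)

lemma card_hist_tree_pos [simp]: "0 < card (hist_tree h)"
  by (simp add: card_gt_0_iff)

section \<open>Growth of the tree size and of the clock\<close>

lemma new_child_notin:
  fixes v :: "nat list"
  assumes "finite t"
  shows "v @ [LEAST i. 1 \<le> i \<and> v @ [i] \<notin> t] \<notin> t"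
proof -
  have "finite ((\<lambda>i. v @ [i]) -` t)"
    using assms by (intro finite_vimageI) (simp_all add: inj_def)
  then have "finite (insert 0 ((\<lambda>i. v @ [i]) -` t))"
    by simp
  then obtain i where "i \<notin> insert 0 ((\<lambda>i. v @ [i]) -` t)"
    using ex_new_if_finite[OF infinite_UNIV_nat] by blast
  then have "1 \<le> i \<and> v @ [i] \<notin> t"
    by simp
  then show ?thesis
    by (rule LeastI2) simp
qed

lemma card_Cons_images:
  fixes A :: "nat list set"
  assumes "finite A"
  shows "card ((\<lambda>w. 1 # w) ` A \<union> (\<lambda>w. 2 # w) ` A) = 2 * card A"
proof -
  have "card ((\<lambda>w. 1 # w) ` A \<union> (\<lambda>w. 2 # w) ` A)
      = card ((\<lambda>w. (1::nat) # w) ` A) + card ((\<lambda>w. 2 # w) ` A)"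
    using assms by (intro card_Un_disjoint) auto
  then show ?thesis
    by (simp add: card_image inj_on_def)
qed

lemma card_rrt_step:
  assumes "finite t"
  shows "card (rrt_step t v) = (if v = [] then 2 * card t + 1 else card t + 1)"
proof (cases "v = []")
  case True
  have "rrt_step t v = insert [] ((\<lambda>w. 1 # w) ` t \<union> (\<lambda>w. 2 # w) ` t)"
    using True by (simp add: rrt_step_def)
  also have "card \<dots> = Suc (card ((\<lambda>w. 1 # w) ` t \<union> (\<lambda>w. 2 # w) ` t))"
    using assms by (intro card_insert_disjoint) auto
  finally show ?thesis
    using True card_Cons_images[OF assms] by simp
next
  case False
  then show ?thesis
    using assms new_child_notin[OF assms, of v] by (simp add: rrt_step_def)
qed

lemma card_hist_tree_ge: "length h + 1 \<le> card (hist_tree h)"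
  by (induction h) (simp_all add: card_rrt_step)

lemma clock_mono_drop: "clock (drop d h) \<le> clock h"
proof (induction d arbitrary: h)
  case (Suc d)
  then show ?case
    by (cases h) (auto intro: order_trans[OF Suc])
qed simp

lemma clock_le_harm: "clock h \<le> harm (length h)"
proof (induction h)
  case (Cons v h)
  have "real (length h + 1) \<le> real (card (hist_tree h))"
    using card_hist_tree_ge[of h] by linarith
  then have "1 / real (card (hist_tree h)) \<le> 1 / real (length h + 1)"
    by (intro divide_left_mono) auto
  then show ?case
    using Cons by (simp add: harm_Suc inverse_eq_divide)
qed (simp add: harm_def)

lemma clock_le_ln: "h \<noteq> [] \<Longrightarrow> clock h \<le> 1 + ln (real (length h))"
  \<comment> \<open>The sequence \<open>harm n - ln n\<close> is decreasing and equals 1 at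
    \<open>n = 1\<close>.\<close>
  using clock_le_harm[of h] euler_mascheroni_sequence_decreasing[of 1 "length h"]
  by (cases h) (simp_all add: harm_expand)

lemma clock_nonneg: "0 \<le> clock h"
  by (induction h) simp_all

text \<open>A doubling replaces the size \<open>c\<close> by \<open>2 * c + 1\<close>; the excess
  \<open>ln (1 + 1 / (2 * c))\<close> over \<open>ln 2\<close> is absorbed by the clock increment \<open>1 / c\<close>.\<close>
lemma ln_card_hist_tree_le: "ln (real (card (hist_tree h))) \<le> clock h + ln 2 * real (doublings h)"
proof (induction h)
  case (Cons v h)
  define c where "c = real (card (hist_tree h))"
  have c: "0 < c" by (simp add: c_def)
  show ?case
  proof (cases "v = []")
    case True
    have "2 * c + 1 = 2 * (c * (1 + 1 / (2 * c)))"
      using c by (simp add: algebra_simps)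
    then have "ln (2 * c + 1) = ln (2 * (c * (1 + 1 / (2 * c))))"
      by simp
    also have "\<dots> = ln 2 + (ln c + ln (1 + 1 / (2 * c)))"
      using c add_pos_pos[of 1 "1 / (2 * c)"] by (simp add: ln_mult)
    also have "\<dots> \<le> ln 2 + (ln c + 1 / (2 * c))"
      using c by (intro add_left_mono ln_add_one_self_le_self) auto
    also have "\<dots> \<le> ln 2 + (ln c + 1 / c)"
      using c by (simp add: field_simps)
    finally show ?thesis
      using True Cons by (simp add: card_rrt_step c_def[symmetric] algebra_simps)
  next
    case False
    have "ln (c + 1) = ln (c * (1 + 1 / c))"
      using c by (simp add: algebra_simps)
    also have "\<dots> = ln c + ln (1 + 1 / c)"
      using c add_pos_pos[of 1 "1 / c"] by (simp add: ln_mult)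
    also have "\<dots> \<le> ln c + 1 / c"
      using c by (intro add_left_mono ln_add_one_self_le_self) auto
    finally show ?thesis
      using False Cons by (simp add: card_rrt_step c_def[symmetric] algebra_simps)
  qed
qed simp

lemma ln_length_le:
  assumes "length h = 2 ^ k"
  shows "real k * ln 2 \<le> clock h + ln 2 * real (doublings h)"
proof -
  have "real k * ln 2 = ln (2 ^ k)" by (simp add: ln_realpow)
  also have "\<dots> \<le> ln (real (card (hist_tree h)))"
  proof (subst ln_le_cancel_iff)
    have "2 ^ k \<le> card (hist_tree h)" using card_hist_tree_ge[of h] assms by simp
    then show "2 ^ k \<le> real (card (hist_tree h))"
      by (metis of_nat_le_iff of_nat_numeral of_nat_power)
  qed auto
  also have "\<dots> \<le> clock h + ln 2 * real (doublings h)"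
    by (rule ln_card_hist_tree_le)
  finally show ?thesis .
qed

section \<open>Node counts at heights relative to the number of doublings\<close>

lemma level_Cons_root:
  "(\<lambda>w. 1 # w) ` level h j \<union> (\<lambda>w. 2 # w) ` level h j \<subseteq> level ([] # h) j"
  by (auto simp: level_def rrt_step_def)

lemma level_Cons_nonroot: "v \<noteq> [] \<Longrightarrow> level h j \<subseteq> level (v # h) j"
  by (auto simp: level_def rrt_step_def)

lemma card_level_Cons_root: "2 * card (level h j) \<le> card (level ([] # h) j)"
  using card_mono[OF finite_level level_Cons_root, of h j] card_Cons_images[OF finite_level, of h j]
  by linarith

lemma card_level_Cons: "card (level h j) \<le> card (level (v # h) j)"
proof (cases "v = []")
  case True
  then show ?thesis using card_level_Cons_root[of h j] by simp
next
  case False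
  then show ?thesis by (intro card_mono level_Cons_nonroot) auto
qed

lemma card_level_drop: "card (level (drop d h) j) \<le> card (level h j)"
proof (induction d arbitrary: h)
  case (Suc d)
  then show ?case
    by (cases h) (auto intro: order_trans[OF Suc] card_level_Cons)
qed simp

lemma card_level_Suc_Cons:
  assumes "v \<in> level h j"
  shows "Suc (card (level h (Suc j))) \<le> card (level (v # h) (Suc j))"
proof -
  define u where "u = v @ [LEAST i. 1 \<le> i \<and> v @ [i] \<notin> hist_tree h]"
  have v: "v \<noteq> []" "length v = doublings h + j"
    using assms by (auto simp: level_def)
  have u: "u \<notin> hist_tree h"
    unfolding u_def by (rule new_child_notin) simp
  have "insert u (level h (Suc j)) \<subseteq> level (v # h) (Suc j)"
    using v by (auto simp: level_def rrt_step_def u_def)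
  then have "card (insert u (level h (Suc j))) \<le> card (level (v # h) (Suc j))"
    by (intro card_mono) auto
  then show ?thesis
    using u by (simp add: level_def)
qed

text \<open>The first doubling places \<open>[1]\<close> and \<open>[2]\<close>, the two copies of
  the root, at relative height 0, and every later doubling at least doubles that level. Before it,
  relative height 0 holds only the excluded root.\<close>

lemma level_zero_ge: "0 < doublings h \<Longrightarrow> 2 ^ doublings h \<le> card (level h 0)"
proof (induction h)
  case (Cons v h)
  show ?case
  proof (cases "v = []")
    case True
    show ?thesis
    proof (cases "doublings h = 0")
      case True
      have "{[1], [2]} \<subseteq> level (v # h) 0"
        using True \<open>v = []\<close> by (auto simp: level_def rrt_step_def)
      then have "card {[1], [2::nat]} \<le> card (level (v # h) 0)"
        by (intro card_mono) auto
      then show ?thesis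
        using True \<open>v = []\<close> by simp
    next
      case False
      then show ?thesis
        using Cons.IH True card_level_Cons_root[of h 0] by simp
    qed
  next
    case False
    then show ?thesis
      using Cons card_level_Cons[of h 0 v] by simp
  qed
qed simp

lemma tree_height_ge: "w \<in> hist_tree h \<Longrightarrow> length w \<le> tree_height (hist_tree h)"
  unfolding tree_height_def by (intro Max_ge) auto

lemma tree_height_ge_level: "level h j \<noteq> {} \<Longrightarrow> doublings h + j \<le> tree_height (hist_tree h)"
  using tree_height_ge by (fastforce simp: level_def)

lemma tree_height_Cons: "tree_height (hist_tree h) \<le> tree_height (hist_tree (v # h))"
proof -
  have "tree_height (hist_tree h) \<in> length ` hist_tree h"
    unfolding tree_height_def by (intro Max_in) auto
  then obtain w where w: "w \<in> hist_tree h" "tree_height (hist_tree h) = length w"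
    by auto
  show ?thesis
  proof (cases "v = []")
    case True
    then have "1 # w \<in> hist_tree (v # h)"
      using w by (simp add: rrt_step_def)
    from tree_height_ge[OF this] show ?thesis
      using w by simp
  next
    case False
    then have "w \<in> hist_tree (v # h)"
      using w by (simp add: rrt_step_def)
    from tree_height_ge[OF this] show ?thesis
      using w by simp
  qed
qed

text \<open>\<open>drop d h\<close> is the history \<open>d\<close> steps earlier. Level counts
  never decrease, so each later increment of the compensator is at least the early count times the
  increment of the clock.\<close>

lemma compensator_drop_ge:
  "real (card (level (drop d h) j)) * (clock h - clock (drop d h))
     \<le> compensator j h - compensator j (drop d h)"
proof (induction d arbitrary: h)
  case (Suc d)
  show ?case
  proof (cases h)
    case (Cons v g)
    have "real (card (level (drop d g) j)) * (1 / real (card (hist_tree g)))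
        \<le> real (card (level g j)) * (1 / real (card (hist_tree g)))"
      using card_level_drop[of d g j] by (intro mult_right_mono) auto
    then show ?thesis
      using Suc[of g] Cons by (simp add: algebra_simps)
  qed simp
qed simp

subsection \<open>Exponential supermartingales\<close>

text \<open>The law of the first \<open>n\<close> picks as an explicit discrete chain. Exponential
  estimates are proved here without filtrations; \<open>prob_history\<close> transfers them to
  \<open>M\<close>.\<close>

fun hist_law :: "nat \<Rightarrow> nat list list pmf" where
  "hist_law 0 = return_pmf []"
| "hist_law (Suc n) = hist_law n \<bind> (\<lambda>h. map_pmf (\<lambda>v. v # h) (pmf_of_set (hist_tree h)))"

text \<open>The hypothesis \<open>step\<close> says that \<open>exp Z\<close> is a supermartingale
  under a uniform pick. The induction integrates out the most recent pick first; the nonnegative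
  integral avoids integrability questions.\<close>

lemma nn_integral_exp_hist_law_le_1:
  fixes Z :: "nat list list \<Rightarrow> real"
  assumes step: "\<And>h. (\<Sum>v\<in>hist_tree h. exp (Z (v # h) - Z h)) \<le> real (card (hist_tree h))"
  shows "(\<integral>\<^sup>+h. ennreal (exp (Z h - Z (drop d h))) \<partial>hist_law (n + d)) \<le> 1"
proof (induction d)
  case (Suc d)
  have "(\<integral>\<^sup>+h. ennreal (exp (Z h - Z (drop (Suc d) h))) \<partial>hist_law (n + Suc d))
      = (\<integral>\<^sup>+h. (\<integral>\<^sup>+v. ennreal (exp (Z (v # h) - Z (drop d h))) \<partial>pmf_of_set (hist_tree h)) \<partial>hist_law (n + d))"
    by (simp add: nn_integral_bind_pmf nn_integral_map_pmf)
  also have "\<dots> \<le> (\<integral>\<^sup>+h. ennreal (exp (Z h - Z (drop d h))) \<partial>hist_law (n + d))"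
  proof (intro nn_integral_mono)
    fix h
    define c where "c = real (card (hist_tree h))"
    have c: "0 < c" by (simp add: c_def)
    have "(\<integral>\<^sup>+v. ennreal (exp (Z (v # h) - Z (drop d h))) \<partial>pmf_of_set (hist_tree h))
       = ennreal ((\<Sum>v\<in>hist_tree h. exp (Z (v # h) - Z (drop d h))) / c)"
      using c by (subst nn_integral_pmf_of_set)
        (auto simp: c_def ennreal_of_nat_eq_real_of_nat divide_ennreal sum_nonneg)
    also have "(\<Sum>v\<in>hist_tree h. exp (Z (v # h) - Z (drop d h)))
       = exp (Z h - Z (drop d h)) * (\<Sum>v\<in>hist_tree h. exp (Z (v # h) - Z h))"
      by (simp add: sum_distrib_left flip: exp_add)
    also have "ennreal (\<dots> / c) \<le> ennreal (exp (Z h - Z (drop d h)))"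
      using step[of h] c by (intro ennreal_leI) (simp add: c_def field_simps)
    finally show "(\<integral>\<^sup>+v. ennreal (exp (Z (v # h) - Z (drop d h))) \<partial>pmf_of_set (hist_tree h))
        \<le> ennreal (exp (Z h - Z (drop d h)))" .
  qed
  also have "\<dots> \<le> 1" by (rule Suc)
  finally show ?case .
qed simp

text \<open>With \<open>p\<close> the share of \<open>S\<close> in \<open>t\<close>, the average of
  \<open>exp (f v)\<close> is at most \<open>1 + (exp \<theta> - 1) * p\<close>, hence at most
  \<open>exp ((exp \<theta> - 1) * p)\<close>. The sign of \<open>\<theta>\<close> is free.\<close>

lemma sum_exp_le_card:
  fixes f :: "'b \<Rightarrow> real"
  assumes t: "finite t" "t \<noteq> {}" and S: "S \<subseteq> t"
    and in_S: "\<And>v. v \<in> S \<Longrightarrow> f v \<le> \<theta>" and notin_S: "\<And>v. v \<in> t - S \<Longrightarrow> f v \<le> 0"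
  shows "(\<Sum>v\<in>t. exp (f v - (exp \<theta> - 1) * (real (card S) / real (card t)))) \<le> real (card t)"
proof -
  define p where "p = real (card S) / real (card t)"
  have c: "0 < real (card t)" using t by (simp add: card_gt_0_iff)
  have "(\<Sum>v\<in>t. exp (f v)) = (\<Sum>v\<in>t - S. exp (f v)) + (\<Sum>v\<in>S. exp (f v))"
    using t S by (intro sum.subset_diff) auto
  also have "\<dots> \<le> (\<Sum>v\<in>t - S. 1) + (\<Sum>v\<in>S. exp \<theta>)"
    using in_S notin_S by (intro add_mono sum_mono) auto
  also have "\<dots> = real (card t) * (1 + (exp \<theta> - 1) * p)"
    using c card_mono[OF t(1) S] by (simp add: p_def card_Diff_subset[OF finite_subset[OF S t(1)] S] of_nat_diff field_simps)
  also have "\<dots> \<le> real (card t) * exp ((exp \<theta> - 1) * p)"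
    using c by (intro mult_left_mono) auto
  finally have "(\<Sum>v\<in>t. exp (f v)) / exp ((exp \<theta> - 1) * p) \<le> real (card t)"
    by (simp add: divide_le_eq)
  then show ?thesis
    by (simp add: sum_divide_distrib p_def[symmetric] exp_diff)
qed

text \<open>Markov's inequality for the exponential supermartingale.\<close>

lemma prob_hist_law_le_exp:
  fixes Z :: "nat list list \<Rightarrow> real"
  assumes step: "\<And>h. (\<Sum>v\<in>hist_tree h. exp (Z (v # h) - Z h)) \<le> real (card (hist_tree h))"
  shows "measure_pmf.prob (hist_law (n + d)) {h. x \<le> Z h - Z (drop d h)} \<le> exp (- x)"
proof -
  define P where "P = hist_law (n + d)"
  have "emeasure P {h. x \<le> Z h - Z (drop d h)} = (\<integral>\<^sup>+h. indicator {h. x \<le> Z h - Z (drop d h)} h \<partial>P)"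
    by (simp add: P_def)
  also have "\<dots> \<le> (\<integral>\<^sup>+h. ennreal (exp (- x)) * ennreal (exp (Z h - Z (drop d h))) \<partial>P)"
  proof (intro nn_integral_mono)
    fix h
    show "indicator {h. x \<le> Z h - Z (drop d h)} h
        \<le> ennreal (exp (- x)) * ennreal (exp (Z h - Z (drop d h)))"
      by (auto simp: indicator_def simp flip: ennreal_mult' exp_add)
  qed
  also have "\<dots> = ennreal (exp (- x)) * (\<integral>\<^sup>+h. ennreal (exp (Z h - Z (drop d h))) \<partial>P)"
    by (intro nn_integral_cmult) auto
  also have "\<dots> \<le> ennreal (exp (- x)) * 1"
    unfolding P_def by (intro mult_left_mono nn_integral_exp_hist_law_le_1 step) auto
  finally show ?thesis
    by (simp add: P_def measure_pmf.emeasure_eq_measure)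
qed

text \<open>The one-step bound with \<open>S\<close> the singleton of the root. Positive
  \<open>\<theta>\<close> controls the upper tail of \<open>doublings\<close>, negative
  \<open>\<theta>\<close> the lower tail.\<close>

lemma prob_doublings_le:
  fixes \<theta> x :: real
  shows "measure_pmf.prob (hist_law n) {h. x \<le> \<theta> * real (doublings h) - (exp \<theta> - 1) * clock h} \<le> exp (- x)"
proof -
  define Z where "Z h = \<theta> * real (doublings h) - (exp \<theta> - 1) * clock h" for h
  have len: "length h = m" if "h \<in> set_pmf (hist_law m)" for h m
    using that by (induction m arbitrary: h) auto
  \<comment> \<open>Written as \<open>0 + n\<close> so that \<open>drop n h\<close> is the empty
    history, where \<open>Z\<close> vanishes.\<close>
  have "measure_pmf.prob (hist_law (0 + n)) {h. x \<le> Z h - Z (drop n h)} \<le> exp (- x)"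
  proof (rule prob_hist_law_le_exp)
    fix h
    have "(\<Sum>v\<in>hist_tree h. exp ((if v = [] then \<theta> else 0)
        - (exp \<theta> - 1) * (real (card {[]::nat list}) / real (card (hist_tree h))))) \<le> real (card (hist_tree h))"
      by (rule sum_exp_le_card) auto
    also have "(\<Sum>v\<in>hist_tree h. exp ((if v = [] then \<theta> else 0)
        - (exp \<theta> - 1) * (real (card {[]::nat list}) / real (card (hist_tree h)))))
        = (\<Sum>v\<in>hist_tree h. exp (Z (v # h) - Z h))"
      by (intro sum.cong refl arg_cong[where f = exp]) (auto simp: Z_def algebra_simps)
    finally show "(\<Sum>v\<in>hist_tree h. exp (Z (v # h) - Z h)) \<le> real (card (hist_tree h))" .
  qed
  also have "measure_pmf.prob (hist_law (0 + n)) {h. x \<le> Z h - Z (drop n h)}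
      = measure_pmf.prob (hist_law n) {h. x \<le> Z h}"
  proof -
    have "Z (drop n h) = 0" if "h \<in> set_pmf (hist_law n)" for h
      using len[OF that] by (simp add: Z_def)
    then show ?thesis
      by (auto intro!: measure_pmf.finite_measure_eq_AE simp: AE_measure_pmf_iff)
  qed
  finally show ?thesis by (simp add: Z_def)
qed

text \<open>The failure of one step of the Euler scheme. Start and end are deterministic times, so
  that a union bound over all of them later covers the random times at which the clock passes given
  values.\<close>

definition stalled :: "real \<Rightarrow> real \<Rightarrow> real \<Rightarrow> nat \<Rightarrow> nat \<Rightarrow> nat list list \<Rightarrow> bool" where
  "stalled a q K d j h \<longleftrightarrow>
     K \<le> real (card (level (drop d h) j)) \<and> a \<le> clock h - clock (drop d h) \<and>
     real (card (level h (Suc j)))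
       < real (card (level (drop d h) (Suc j))) + q * real (card (level (drop d h) j))"

text \<open>On the event, the compensator gains at least \<open>a\<close> times the initial count
  while level \<open>Suc j\<close> gains less than \<open>q\<close> times it. The exponent
  \<open>Z\<close> with the negative parameter \<open>- \<theta>\<close> therefore rises by at least
  \<open>x * K\<close>.\<close>

lemma prob_stalled_le:
  assumes "0 \<le> \<theta>" "0 \<le> x" "x \<le> (1 - exp (- \<theta>)) * a - \<theta> * q"
  shows "measure_pmf.prob (hist_law (n + d)) {h. stalled a q K d j h} \<le> exp (- (x * K))"
proof -
  define Z where "Z h = - \<theta> * real (card (level h (Suc j))) - (exp (- \<theta>) - 1) * compensator j h" for h
  have "measure_pmf.prob (hist_law (n + d)) {h. stalled a q K d j h}
      \<le> measure_pmf.prob (hist_law (n + d)) {h. x * K \<le> Z h - Z (drop d h)}"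
  proof (intro measure_pmf.finite_measure_mono)
    show "{h. stalled a q K d j h} \<subseteq> {h. x * K \<le> Z h - Z (drop d h)}"
    proof safe
      fix h
      assume h: "stalled a q K d j h"
      define g where "g = drop d h"
      define A where "A = real (card (level g j))"
      have e: "0 \<le> 1 - exp (- \<theta>)" using assms by simp
      have "x * K \<le> x * A"
        using h assms by (intro mult_left_mono) (auto simp: stalled_def A_def g_def)
      also have "\<dots> \<le> ((1 - exp (- \<theta>)) * a - \<theta> * q) * A"
        using assms by (intro mult_right_mono) (auto simp: A_def)
      also have "\<dots> = (1 - exp (- \<theta>)) * (A * a) - \<theta> * (q * A)"
        by (simp add: algebra_simps)
      also have "\<dots> \<le> (1 - exp (- \<theta>)) * (compensator j h - compensator j g)
          - \<theta> * (real (card (level h (Suc j))) - real (card (level g (Suc j))))"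
      proof (intro diff_mono mult_left_mono e assms)
        have "A * a \<le> A * (clock h - clock g)"
          using h by (intro mult_left_mono) (auto simp: stalled_def A_def g_def)
        then show "A * a \<le> compensator j h - compensator j g"
          using compensator_drop_ge[of d h j] by (simp add: A_def g_def)
        show "real (card (level h (Suc j))) - real (card (level g (Suc j))) \<le> q * A"
          using h by (simp add: stalled_def A_def g_def)
      qed
      also have "\<dots> = Z h - Z g"
        by (simp add: Z_def algebra_simps)
      finally show "x * K \<le> Z h - Z (drop d h)" by (simp add: g_def)
    qed
  qed simp
  also have "\<dots> \<le> exp (- (x * K))"
  proof (rule prob_hist_law_le_exp)
    fix h
    have "(\<Sum>v\<in>hist_tree h. exp (Z (v # h) - Z h))
      = (\<Sum>v\<in>hist_tree h. exp (- \<theta> * (real (card (level (v # h) (Suc j))) - real (card (level h (Suc j))))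
          - (exp (- \<theta>) - 1) * (real (card (level h j)) / real (card (hist_tree h)))))"
      by (intro sum.cong refl arg_cong[where f = exp]) (simp add: Z_def algebra_simps)
    also have "\<dots> \<le> real (card (hist_tree h))"
    proof (rule sum_exp_le_card)
      show "level h j \<subseteq> hist_tree h" by (auto simp: level_def)
      show "- \<theta> * (real (card (level (v # h) (Suc j))) - real (card (level h (Suc j)))) \<le> - \<theta>"
        if "v \<in> level h j" for v
        using mult_left_mono[of 1 "real (card (level (v # h) (Suc j))) - real (card (level h (Suc j)))" \<theta>]
          card_level_Suc_Cons[OF that] assms(1) by simp
      \<comment> \<open>All other picks, doublings included, can only raise the count, which lowers
        the exponent.\<close>
      show "- \<theta> * (real (card (level (v # h) (Suc j))) - real (card (level h (Suc j)))) \<le> 0"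
        if "v \<in> hist_tree h - level h j" for v
        using card_level_Cons[of h "Suc j" v] assms(1) by simp
    qed auto
    finally show "(\<Sum>v\<in>hist_tree h. exp (Z (v # h) - Z h)) \<le> real (card (hist_tree h))" .
  qed
  finally show ?thesis .
qed

subsection \<open>Advance of the front\<close>

text \<open>A weak Stirling bound: the quotient of consecutive right-hand sides is handled by
  \<open>(1 + 1 / m) ^ Suc m >= exp 1\<close>, which comes from \<open>ln x <= x - 1\<close> at the
  reciprocal of \<open>1 + 1 / m\<close>.\<close>

lemma fact_le_exp:
  assumes "1 \<le> m"
  shows "fact m \<le> exp 1 * real m * (real m / exp 1) ^ m"
  using assms
proof (induction m rule: dec_induct)
  case (step m)
  have m: "0 < real m" using step by simp
  have "- ln (1 - 1 / real (Suc m)) = ln (1 + 1 / real m)"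
  proof -
    have "1 - 1 / real (Suc m) = inverse (1 + 1 / real m)"
      using m by (simp add: field_simps)
    then show ?thesis
      using m by (simp add: ln_inverse add_pos_pos)
  qed
  moreover have "ln (1 - 1 / real (Suc m)) \<le> - 1 / real (Suc m)"
    using ln_le_minus_one[of "1 - 1 / real (Suc m)"] m by simp
  ultimately have "1 / real (Suc m) \<le> ln (1 + 1 / real m)"
    by simp
  then have "1 \<le> real (Suc m) * ln (1 + 1 / real m)"
    by (simp add: divide_le_eq mult.commute)
  then have "exp 1 \<le> exp (real (Suc m) * ln (1 + 1 / real m))"
    by simp
  also have "\<dots> = (1 + 1 / real m) ^ Suc m"
    using m by (subst exp_of_nat_mult) (simp add: add_pos_pos)
  also have "\<dots> = (real (Suc m) / real m) ^ Suc m"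
    using m by (simp add: field_simps)
  finally have e: "exp 1 * real m ^ Suc m \<le> real (Suc m) ^ Suc m"
    using m by (simp add: power_divide field_simps del: power_Suc)
  have "fact (Suc m) \<le> real (Suc m) * (exp 1 * real m * (real m / exp 1) ^ m)"
    using mult_left_mono[OF step.IH, of "real (Suc m)"] by simp
  also have "\<dots> = exp 1 * real (Suc m) * ((exp 1 * real m ^ Suc m) / exp 1 ^ Suc m)"
    by (simp add: power_divide)
  also have "\<dots> \<le> exp 1 * real (Suc m) * (real (Suc m) ^ Suc m / exp 1 ^ Suc m)"
    by (intro mult_left_mono divide_right_mono e) auto
  finally show ?case
    by (simp add: power_divide)
qed simp

text \<open>\<open>R\<close> Euler steps of size \<open>q\<close> advance the front by
  \<open>m\<close> levels, that is at speed \<open>c\<close>, without loss of mass. First fix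
  \<open>m\<close> with \<open>(m / c) ^ m / fact m > 1\<close>, possible by Stirling since
  \<open>c < exp 1\<close>; then let \<open>R\<close> grow, for \<open>q ^ m * (R choose m)\<close>
  tends to that value.\<close>

lemma ex_euler_parameters:
  fixes c :: real
  assumes "0 < c" "c < exp 1"
  obtains m R :: nat and q :: real
  where "1 \<le> m" "0 < R" "0 < q" "q \<le> 1" "1 \<le> q ^ m * real (R choose m)" "real m = c * real R * q"
proof -
  define x where "x = c / exp 1"
  have x: "0 < x" "x < 1" using assms by (simp_all add: x_def)
  have "(\<lambda>m. exp 1 * (real m * x ^ m)) \<longlonglongrightarrow> exp 1 * 0"
    using x by (intro tendsto_intros powser_times_n_limit_0) auto
  then have "eventually (\<lambda>m. exp 1 * (real m * x ^ m) < 1) sequentially"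
    by (rule order_tendstoD(2)) simp
  then have "eventually (\<lambda>m. exp 1 * (real m * x ^ m) < 1 \<and> 1 \<le> m) sequentially"
    by (intro eventually_conj eventually_ge_at_top)
  then obtain m :: nat where m: "exp 1 * (real m * x ^ m) < 1" "1 \<le> m"
    by (auto simp: eventually_sequentially)
  have "fact m * c ^ m \<le> exp 1 * real m * (real m / exp 1) ^ m * c ^ m"
    using assms m by (intro mult_right_mono fact_le_exp) auto
  also have "\<dots> = exp 1 * (real m * x ^ m) * real m ^ m"
    by (simp add: x_def power_divide)
  also have "\<dots> < 1 * real m ^ m"
    using m by (intro mult_strict_right_mono) auto
  finally have less: "1 < (real m / c) ^ m * (1 / fact m)"
    using assms by (simp add: power_divide field_simps)
  \<comment> \<open>This is \<open>q ^ m * (R choose m)\<close> for \<open>R = m + N\<close> and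
    \<open>q = m / (c * R)\<close>, factored to fit \<open>fact_binomial_limit\<close>.\<close>
  have "(\<lambda>N. (real m / c) ^ m * ((real N / real (m + N)) ^ m * (real ((m + N) choose N) / real (N ^ m))))
      \<longlonglongrightarrow> (real m / c) ^ m * (1 ^ m * (1 / fact m))"
  proof (intro tendsto_mult tendsto_power tendsto_const)
    show "(\<lambda>N. real N / real (m + N)) \<longlonglongrightarrow> 1"
      by real_asymp
    show "(\<lambda>N. real ((m + N) choose N) / real (N ^ m)) \<longlonglongrightarrow> 1 / fact m"
      using fact_binomial_limit[of m, where ?'a = real] by simp
  qed
  then have "eventually (\<lambda>N. 1 < (real m / c) ^ m * ((real N / real (m + N)) ^ m * (real ((m + N) choose N) / real (N ^ m)))) sequentially"
    using less by (intro order_tendstoD(1)[where a = 1]) auto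
  \<comment> \<open>This ensures \<open>q <= 1\<close>.\<close>
  moreover have "eventually (\<lambda>N. real m / c \<le> real N) sequentially"
    by real_asymp
  ultimately have "eventually (\<lambda>N. 1 < (real m / c) ^ m * ((real N / real (m + N)) ^ m * (real ((m + N) choose N) / real (N ^ m)))
      \<and> real m / c \<le> real N \<and> 1 \<le> N) sequentially"
    by (intro eventually_conj eventually_ge_at_top)
  then obtain N where N: "1 < (real m / c) ^ m * ((real N / real (m + N)) ^ m * (real ((m + N) choose N) / real (N ^ m)))"
    "real m / c \<le> real N" "1 \<le> N"
    by (auto simp: eventually_sequentially)
  define q where "q = real m / (c * real (m + N))"
  show thesis
  proof (rule that)
    show "1 \<le> m" "0 < m + N" using m by auto
    show "0 < q" using assms m by (simp add: q_def)
    have "real m \<le> c * real N" using N(2) assms by (simp add: divide_le_eq mult.commute)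
    also have "\<dots> \<le> c * real (m + N)" using assms by simp
    finally show "q \<le> 1" using assms m by (simp add: q_def divide_le_eq)
    show "real m = c * real (m + N) * q" using assms m by (simp add: q_def)
    have "(real m / c) ^ m * ((real N / real (m + N)) ^ m * (real ((m + N) choose N) / real (N ^ m)))
       = q ^ m * real ((m + N) choose m)"
      using N by (simp add: q_def power_divide power_mult_distrib binomial_symmetric[of m "m + N"])
    then show "1 \<le> q ^ m * real ((m + N) choose m)" using N by simp
  qed
qed

text \<open>A deterministic induction over stages, each raising the clock by at least
  \<open>a\<close> and at most \<open>a'\<close>, the difference covering the overshoot of a single
  pick. Stages are grouped into blocks of \<open>R\<close>; a block moves a level with
  \<open>K\<close> nodes up by \<open>m\<close>.\<close>

lemma front_advance:
  fixes T :: "nat \<Rightarrow> real" and A :: "nat \<Rightarrow> nat \<Rightarrow> real"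
  assumes "mono T" and nonneg: "\<And>n j. 0 \<le> A n j" and A_mono: "\<And>n n' j. n \<le> n' \<Longrightarrow> A n j \<le> A n' j"
    and growth: "\<And>n n' j. \<lbrakk>n \<le> n'; n' \<le> N; j \<le> N; L \<le> A n j; a \<le> T n' - T n\<rbrakk> \<Longrightarrow> A n (Suc j) + q * A n j \<le> A n' (Suc j)"
    and incr: "\<And>n. n\<^sub>0 \<le> n \<Longrightarrow> T (Suc n) \<le> T n + (a' - a)" and a: "0 < a" "a \<le> a'"
    and start: "K \<le> A n\<^sub>0 0" and K: "0 < K" "L \<le> K * q ^ m"
    and q: "0 < q" "q \<le> 1" and R: "0 < R" "1 \<le> q ^ m * real (R choose m)"
    and i: "T n\<^sub>0 + real i * a' \<le> T N" and n0: "n\<^sub>0 \<le> N"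
  shows "K \<le> A N (m * (i div R))"
proof -
  have mR: "m \<le> R"
  proof (rule ccontr)
    assume "\<not> m \<le> R"
    then show False using R by (simp add: binomial_eq_0)
  qed
  \<comment> \<open>The bound \<open>n\<^sub>0 + i \<le> u\<close> keeps the levels involved at most
    \<open>N\<close>, as \<open>growth\<close> demands, and keeps \<open>u\<close> beyond
    \<open>n\<^sub>0\<close>, where \<open>incr\<close> limits the overshoot.\<close>
  have "\<exists>u. n\<^sub>0 + i \<le> u \<and> u \<le> N \<and> T u \<le> T n\<^sub>0 + real i * a'
      \<and> (\<forall>j\<le>m. K * (q ^ j * real ((i mod R) choose j)) \<le> A u (m * (i div R) + j))"
    using i
  proof (induction i)
    case 0
    have "K * (q ^ j * real (0 choose j)) \<le> A n\<^sub>0 j" for j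
      using start nonneg by (cases j) auto
    then show ?case using n0 by (intro exI[of _ n\<^sub>0]) auto
  next
    case (Suc i)
    have "T n\<^sub>0 + real i * a' \<le> T N" using Suc.prems a by (simp add: algebra_simps)
    from Suc.IH[OF this] obtain u where u: "n\<^sub>0 + i \<le> u" "u \<le> N" "T u \<le> T n\<^sub>0 + real i * a'"
      and Au: "\<And>j. j \<le> m \<Longrightarrow> K * (q ^ j * real ((i mod R) choose j)) \<le> A u (m * (i div R) + j)"
      by blast
    \<comment> \<open>The first time at which the clock has gained \<open>a\<close>; by
      \<open>incr\<close> the gain is then at most \<open>a'\<close>.\<close>
    define u' where "u' = (LEAST n. T u + a \<le> T n)"
    have ex: "T u + a \<le> T N" using u Suc.prems a by (simp add: algebra_simps)
    have u': "T u + a \<le> T u'" "u' \<le> N"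
      unfolding u'_def using ex by (auto intro: LeastI Least_le)
    have uu': "u < u'"
    proof (rule ccontr)
      assume "\<not> u < u'"
      then have "T u' \<le> T u" using \<open>mono T\<close> by (simp add: monoD)
      then show False using u' a by simp
    qed
    have "\<not> T u + a \<le> T (u' - 1)"
      using not_less_Least[of "u' - 1" "\<lambda>n. T u + a \<le> T n"] uu' by (simp add: u'_def[symmetric])
    moreover have "T u' \<le> T (u' - 1) + (a' - a)"
      using incr[of "u' - 1"] u uu' by simp
    ultimately have Tu': "T u' \<le> T n\<^sub>0 + real (Suc i) * a'"
      using u by (simp add: algebra_simps)
    define b r where "b = i div R" and "r = i mod R"
    have br: "i = b * R + r" "r < R" using R by (simp_all add: b_def r_def)
    have step: "K * (q ^ j * real (Suc r choose j)) \<le> A u' (m * b + j)" if "j \<le> m" for j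
    proof (cases j)
      case 0
      then show ?thesis
        using Au[of 0] A_mono[of u u' "m * b"] uu' by (simp add: b_def r_def)
    next
      case (Suc k)
      have IH1: "K * (q ^ Suc k * real (r choose Suc k)) \<le> A u (m * b + Suc k)"
        and IH0: "K * (q ^ k * real (r choose k)) \<le> A u (m * b + k)"
        using Au[of "Suc k"] Au[of k] that Suc by (simp_all add: b_def r_def)
      show ?thesis
      \<comment> \<open>For \<open>k <= r\<close> the coefficient is at least 1, so the parent level
        has at least \<open>K * q ^ m >= L\<close> nodes, \<open>growth\<close> applies and Pascal's
        rule gives the new coefficient. Otherwise the new coefficient is 0.\<close>
      proof (cases "k \<le> r")
        case True
        have "m * b + k \<le> R * b + r"
          using mR True by (intro add_mono mult_right_mono) auto
        also have "\<dots> \<le> N" using br u by (simp add: mult.commute)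
        finally have idx: "m * b + k \<le> N" .
        have "K * q ^ m \<le> K * (q ^ k * real (r choose k))"
        proof (intro mult_left_mono)
          have "q ^ m * 1 \<le> q ^ k * real (r choose k)"
          proof (intro mult_mono power_decreasing)
            have "0 < r choose k" using True by simp
            then show "1 \<le> real (r choose k)" by linarith
          qed (use q that Suc in auto)
          then show "q ^ m \<le> q ^ k * real (r choose k)" by simp
        qed (use K in auto)
        then have "L \<le> A u (m * b + k)" using K IH0 by linarith
        from growth[OF _ u'(2) idx this] have g: "A u (Suc (m * b + k)) + q * A u (m * b + k) \<le> A u' (Suc (m * b + k))"
          using uu' u' by simp
        have "K * (q ^ Suc k * real (Suc r choose Suc k))
            = K * (q ^ Suc k * real (r choose Suc k)) + q * (K * (q ^ k * real (r choose k)))"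
          by (simp add: algebra_simps)
        also have "\<dots> \<le> A u (m * b + Suc k) + q * A u (m * b + k)"
          using q by (intro add_mono mult_left_mono IH0 IH1) auto
        finally show ?thesis using g Suc by simp
      next
        case False
        then have zero: "Suc r choose j = 0" using Suc by (intro binomial_eq_0) simp
        show ?thesis unfolding zero using nonneg by simp
      qed
    qed
    have "\<forall>j\<le>m. K * (q ^ j * real ((Suc i mod R) choose j)) \<le> A u' (m * (Suc i div R) + j)"
    proof (cases "Suc r = R")
      case True
      then have e: "Suc i = Suc b * R" using br by simp
      \<comment> \<open>At the end of a block the level \<open>j = m\<close> has \<open>K\<close>
        nodes again and becomes the base level of the next block.\<close>
      have "K * 1 \<le> K * (q ^ m * real (R choose m))"
        using K R by (intro mult_left_mono) auto
      also have "\<dots> \<le> A u' (m * b + m)"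
        using step[of m] True by simp
      finally have "K \<le> A u' (m * Suc b)" by (simp add: add.commute)
      then have "K * (q ^ j * real (0 choose j)) \<le> A u' (m * Suc b + j)" for j
        using nonneg by (cases j) auto
      moreover have "Suc i div R = Suc b" "Suc i mod R = 0"
        using R unfolding e by simp_all
      ultimately show ?thesis by simp
    next
      case False
      then have "Suc r < R" using br by simp
      moreover have "Suc i = Suc r + b * R" using br by simp
      ultimately have "Suc i div R = b" "Suc i mod R = Suc r"
        using div_mult_self1[of R "Suc r" b] mod_mult_self1[of "Suc r" b R] by simp_all
      then show ?thesis using step by simp
    qed
    moreover have "n\<^sub>0 + Suc i \<le> u'" using u uu' by simp
    ultimately show ?case using u' Tu' by blast
  qed
  then obtain u where u: "u \<le> N" "\<forall>j\<le>m. K * (q ^ j * real ((i mod R) choose j)) \<le> A u (m * (i div R) + j)"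
    by blast
  have "K \<le> A u (m * (i div R))" using u(2)[rule_format, of 0] by simp
  also have "\<dots> \<le> A N (m * (i div R))" using u(1) by (rule A_mono)
  finally show ?thesis .
qed

subsection \<open>The law of the history\<close>

definition history :: "(nat \<Rightarrow> 'a \<Rightarrow> nat list) \<Rightarrow> nat \<Rightarrow> 'a \<Rightarrow> nat list list" where
  "history \<nu> n \<omega> = map (\<lambda>i. \<nu> i \<omega>) (rev [0..<n])"

lemma history_simps [simp]:
  "history \<nu> 0 \<omega> = []"
  "history \<nu> (Suc n) \<omega> = \<nu> n \<omega> # history \<nu> n \<omega>"
  by (simp_all add: history_def)

lemma length_history [simp]: "length (history \<nu> n \<omega>) = n"
  by (simp add: history_def)

lemma drop_history [simp]: "drop d (history \<nu> (n + d) \<omega>) = history \<nu> n \<omega>"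
  by (induction d) simp_all

lemma nth_history: "i < n \<Longrightarrow> history \<nu> n \<omega> ! (n - 1 - i) = \<nu> i \<omega>"
  by (simp add: history_def rev_nth)

lemma history_eq_iff:
  assumes "length g = n"
  shows "history \<nu> n \<omega> = g \<longleftrightarrow> (\<forall>i<n. \<nu> i \<omega> = g ! (n - 1 - i))"
proof
  assume R: "\<forall>i<n. \<nu> i \<omega> = g ! (n - 1 - i)"
  show "history \<nu> n \<omega> = g"
  proof (rule nth_equalityI)
    fix i assume "i < length (history \<nu> n \<omega>)"
    then have i: "i < n" by simp
    then have "history \<nu> n \<omega> ! i = \<nu> (n - 1 - i) \<omega>"
      using nth_history[of "n - 1 - i" n \<nu> \<omega>] by simp
    also have "\<dots> = g ! i" using R i by simp
    finally show "history \<nu> n \<omega> ! i = g ! i" .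
  qed (use assms in simp)
qed (auto simp: nth_history[symmetric])

lemma pmf_hist_law_Suc:
  "pmf (hist_law (Suc n)) [] = 0"
  "pmf (hist_law (Suc n)) (v # g) = pmf (hist_law n) g * (if v \<in> hist_tree g then 1 / real (card (hist_tree g)) else 0)"
proof -
  show "pmf (hist_law (Suc n)) [] = 0"
    by (auto simp: pmf_eq_0_set_pmf)
  have "pmf (map_pmf (\<lambda>v. v # h) (pmf_of_set (hist_tree h))) (v # g)
      = indicator {g} h * pmf (pmf_of_set (hist_tree g)) v" for h
  proof (cases "h = g")
    case True
    then show ?thesis
      using pmf_map_inj'[of "\<lambda>v. v # g" "pmf_of_set (hist_tree g)" v] by (simp add: inj_def)
  next
    case False
    then show ?thesis by (auto simp: pmf_eq_0_set_pmf)
  qed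
  then have "pmf (hist_law (Suc n)) (v # g)
      = (\<integral>h. indicator {g} h * pmf (pmf_of_set (hist_tree g)) v \<partial>hist_law n)"
    by (simp add: pmf_bind)
  also have "\<dots> = pmf (hist_law n) g * pmf (pmf_of_set (hist_tree g)) v"
    by (simp add: measure_pmf_single)
  finally show "pmf (hist_law (Suc n)) (v # g)
      = pmf (hist_law n) g * (if v \<in> hist_tree g then 1 / real (card (hist_tree g)) else 0)"
    by (simp add: indicator_def)
qed

abbreviation (input) height_const :: real where
  "height_const \<equiv> (1 + exp 1) / (1 + ln 2)"

lemma filterlim_floor_log: "filterlim floor_log sequentially sequentially"
  unfolding filterlim_at_top
proof
  fix Z
  have "Z \<le> floor_log n" if "2 ^ Z \<le> n" for n
    using monoD[OF floor_log_mono that] by simp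
  then show "eventually (\<lambda>n. Z \<le> floor_log n) sequentially"
    by (auto simp: eventually_sequentially)
qed

context rrt_doubling
begin

lemma tau_eq: "\<omega> \<in> space M \<Longrightarrow> \<tau> n \<omega> = hist_tree (history \<nu> n \<omega>)"
  by (induction n) (simp_all add: tree_0 tree_Suc)

lemma measurable_history [measurable]: "history \<nu> n \<in> measurable M (count_space UNIV)"
proof (induction n)
  case (Suc n)
  have "(\<lambda>\<omega>. \<nu> n \<omega> # history \<nu> n \<omega>) \<in> measurable M (count_space UNIV)"
  proof (rule measurable_compose_countable[OF _ pick_measurable])
    show "(\<lambda>\<omega>. v # history \<nu> n \<omega>) \<in> measurable M (count_space UNIV)" for v
      using Suc by (rule measurable_compose) simp
  qed
  then show ?case by simp
qed simp

lemma sets_history [measurable]: "{\<omega> \<in> space M. P (history \<nu> n \<omega>)} \<in> sets M"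
proof -
  have "history \<nu> n -` {h. P h} \<inter> space M \<in> sets M"
    by (rule measurable_sets[OF measurable_history]) simp
  also have "history \<nu> n -` {h. P h} \<inter> space M = {\<omega> \<in> space M. P (history \<nu> n \<omega>)}"
    by auto
  finally show ?thesis .
qed

text \<open>Past trees are functions of past picks, so the conditioning event of
  \<open>uniform_pick\<close> is the event that the history equals \<open>g\<close>.\<close>

lemma prob_next_pick:
  "prob {\<omega> \<in> space M. history \<nu> (Suc n) \<omega> = v # g}
     = prob {\<omega> \<in> space M. history \<nu> n \<omega> = g} * (if v \<in> hist_tree g then 1 / real (card (hist_tree g)) else 0)"
proof -
  define E where "E = {\<omega> \<in> space M. history \<nu> n \<omega> = g}"
  define F where "F w = {\<omega> \<in> space M. history \<nu> (Suc n) \<omega> = w # g}" for w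
  have [measurable]: "E \<in> sets M" "F w \<in> sets M" for w
    unfolding E_def F_def by (rule sets_history)+
  have FE: "F w \<subseteq> E" for w by (auto simp: E_def F_def)
  show ?thesis
  proof (cases "prob E = 0")
    case True
    then have "prob (F v) = 0"
      using finite_measure_mono[OF FE, of v] by (simp add: measure_le_0_iff)
    then show ?thesis using True by (simp add: E_def F_def)
  next
    case False
    then have "E \<noteq> {}" by auto
    then have len: "length g = n" by (auto simp: E_def)
    define t where "t i = hist_tree (drop (n - i) g)" for i
    define u where "u i = g ! (n - 1 - i)" for i
    have E_iff: "(\<forall>i\<le>n. \<tau> i \<omega> = t i) \<and> (\<forall>i<n. \<nu> i \<omega> = u i) \<longleftrightarrow> history \<nu> n \<omega> = g"
      if "\<omega> \<in> space M" for \<omega>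
    proof -
      have "\<tau> i \<omega> = t i" if "history \<nu> n \<omega> = g" "i \<le> n" for i
        using drop_history[of "n - i" \<nu> i \<omega>] that tau_eq[OF \<open>\<omega> \<in> space M\<close>, of i] by (simp add: t_def)
      then show ?thesis
        using history_eq_iff[OF len, of \<nu> \<omega>] by (auto simp: u_def)
    qed
    then have E: "{\<omega> \<in> space M. (\<forall>i\<le>n. \<tau> i \<omega> = t i) \<and> (\<forall>i<n. \<nu> i \<omega> = u i)} = E"
      by (auto simp: E_def)
    have pick: "prob (F w) = prob E / real (card (hist_tree g))" if "w \<in> hist_tree g" for w
    proof -
      have "\<P>(\<omega> in M. \<nu> n \<omega> = w \<bar> (\<forall>i\<le>n. \<tau> i \<omega> = t i) \<and> (\<forall>i<n. \<nu> i \<omega> = u i))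
          = 1 / real (card (t n))"
      proof (rule uniform_pick)
        show "0 < prob {\<omega> \<in> space M. (\<forall>i\<le>n. \<tau> i \<omega> = t i) \<and> (\<forall>i<n. \<nu> i \<omega> = u i)}"
          unfolding E using False by (simp add: zero_less_measure_iff)
      qed (use that in \<open>simp add: t_def\<close>)
      moreover have "{\<omega> \<in> space M. \<nu> n \<omega> = w \<and> (\<forall>i\<le>n. \<tau> i \<omega> = t i) \<and> (\<forall>i<n. \<nu> i \<omega> = u i)} = F w"
        using E_iff by (auto simp: F_def)
      ultimately have "prob (F w) / prob E = 1 / real (card (t n))"
        by (simp only: cond_prob_def E)
      then show ?thesis
        using False by (simp add: t_def field_simps)
    qed
    show ?thesis
    proof (cases "v \<in> hist_tree g")
      case True
      then show ?thesis using pick[OF True] by (simp add: E_def F_def)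
    next
      case v: False
      \<comment> \<open>The picks inside the tree already carry the whole mass of \<open>E\<close>,
        which leaves probability 0 for \<open>v\<close>.\<close>
      have "prob (\<Union>w\<in>insert v (hist_tree g). F w) = (\<Sum>w\<in>insert v (hist_tree g). prob (F w))"
      proof (rule finite_measure_finite_Union)
        show "disjoint_family_on F (insert v (hist_tree g))"
          by (auto simp: disjoint_family_on_def F_def)
      qed auto
      also have "\<dots> = prob (F v) + prob E"
        using v pick by simp
      finally have "prob (F v) + prob E \<le> prob E"
        using finite_measure_mono[of "\<Union>w\<in>insert v (hist_tree g). F w" E] FE by auto
      then show ?thesis
        using v by (simp add: E_def F_def measure_le_0_iff)
    qed
  qed
qed

lemma prob_history_eq: "prob {\<omega> \<in> space M. history \<nu> n \<omega> = h} = pmf (hist_law n) h"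
proof (induction n arbitrary: h)
  case 0
  then show ?case by (cases h) (auto simp: prob_space)
next
  case (Suc n)
  show ?case
  proof (cases h)
    case Nil
    then show ?thesis by (simp add: pmf_hist_law_Suc del: hist_law.simps)
  next
    case (Cons v g)
    then show ?thesis
      using prob_next_pick[of n v g] Suc by (simp add: pmf_hist_law_Suc del: hist_law.simps history_simps)
  qed
qed

lemma distr_history: "distr M (count_space UNIV) (history \<nu> n) = measure_pmf (hist_law n)"
proof (rule measure_eqI_countable)
  fix h :: "nat list list"
  have "emeasure (distr M (count_space UNIV) (history \<nu> n)) {h} = prob {\<omega> \<in> space M. history \<nu> n \<omega> = h}"
    by (subst emeasure_distr) (auto simp: emeasure_eq_measure vimage_def Int_def conj_commute)
  then show "emeasure (distr M (count_space UNIV) (history \<nu> n)) {h} = emeasure (hist_law n) {h}"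
    by (simp add: prob_history_eq emeasure_pmf_single)
qed auto

lemma prob_history:
  "prob {\<omega> \<in> space M. P (history \<nu> n \<omega>)} = measure_pmf.prob (hist_law n) {h. P h}"
proof -
  have "measure_pmf.prob (hist_law n) {h. P h} = measure (distr M (count_space UNIV) (history \<nu> n)) {h. P h}"
    by (simp add: distr_history)
  also have "\<dots> = prob {\<omega> \<in> space M. P (history \<nu> n \<omega>)}"
    by (subst measure_distr) (auto simp: vimage_def Int_def conj_commute)
  finally show ?thesis by simp
qed

section \<open>Almost sure estimates along powers of two\<close>

lemma AE_eventually_not:
  assumes "\<And>k. {\<omega> \<in> space M. P k \<omega>} \<in> sets M" "\<And>k. prob {\<omega> \<in> space M. P k \<omega>} \<le> b k" "summable b"
  shows "AE \<omega> in M. eventually (\<lambda>k. \<not> P k \<omega>) sequentially"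
proof -
  have "AE \<omega> in M. eventually (\<lambda>k. \<omega> \<in> space M - {\<omega> \<in> space M. P k \<omega>}) sequentially"
  proof (rule borel_cantelli_AE1)
    show "summable (\<lambda>k. prob {\<omega> \<in> space M. P k \<omega>})"
      using assms(3) by (rule summable_comparison_test') (use assms(2) in auto)
  qed (use assms in \<open>auto simp: emeasure_eq_measure\<close>)
  then show ?thesis
    by (rule AE_mp) (auto intro!: AE_I2 elim: eventually_mono)
qed

lemma AE_doublings_upper:
  fixes \<epsilon> :: real
  assumes "0 < \<epsilon>"
  shows "AE \<omega> in M. eventually (\<lambda>k. real (doublings (history \<nu> (2 ^ k) \<omega>))
           \<le> (1 + \<epsilon>) * clock (history \<nu> (2 ^ k) \<omega>) + \<epsilon> * real k) sequentially"
proof -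
  \<comment> \<open>Chosen so that \<open>1 / (1 - \<theta>)\<close>, an upper bound of
    \<open>exp \<theta>\<close>, equals \<open>1 + (1 + \<epsilon>) * \<theta>\<close>. The slack
    \<open>\<epsilon> * real k\<close> then makes the error geometric in \<open>k\<close>.\<close>
  define \<theta> where "\<theta> = \<epsilon> / (1 + \<epsilon>)"
  have \<theta>: "0 < \<theta>" "\<theta> < 1" using assms by (simp_all add: \<theta>_def)
  have "exp \<theta> * (1 - \<theta>) \<le> exp \<theta> * exp (- \<theta>)"
    using exp_ge_add_one_self[of "- \<theta>"] by (intro mult_left_mono) auto
  then have "exp \<theta> \<le> 1 / (1 - \<theta>)"
    using \<theta> by (simp add: exp_minus field_simps)
  also have "1 / (1 - \<theta>) = 1 + \<epsilon>"
    using assms by (simp add: \<theta>_def field_simps)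
  also have "\<dots> = 1 + (1 + \<epsilon>) * \<theta>"
    using assms by (simp add: \<theta>_def field_simps)
  finally have e: "exp \<theta> - 1 \<le> (1 + \<epsilon>) * \<theta>" by simp
  define P where "P k h \<longleftrightarrow> (1 + \<epsilon>) * clock h + \<epsilon> * real k < real (doublings h)" for k h
  have "AE \<omega> in M. eventually (\<lambda>k. \<not> P k (history \<nu> (2 ^ k) \<omega>)) sequentially"
  proof (rule AE_eventually_not)
    fix k
    have "prob {\<omega> \<in> space M. P k (history \<nu> (2 ^ k) \<omega>)} = measure_pmf.prob (hist_law (2 ^ k)) {h. P k h}"
      by (rule prob_history)
    also have "\<dots> \<le> measure_pmf.prob (hist_law (2 ^ k))
        {h. \<theta> * \<epsilon> * real k \<le> \<theta> * real (doublings h) - (exp \<theta> - 1) * clock h}"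
    proof (intro measure_pmf.finite_measure_mono Collect_mono impI)
      fix h assume "P k h"
      then have "\<theta> * ((1 + \<epsilon>) * clock h + \<epsilon> * real k) \<le> \<theta> * real (doublings h)"
        using \<theta> by (intro mult_left_mono) (auto simp: P_def)
      moreover have "(exp \<theta> - 1) * clock h \<le> (1 + \<epsilon>) * \<theta> * clock h"
        using e clock_nonneg by (intro mult_right_mono)
      ultimately show "\<theta> * \<epsilon> * real k \<le> \<theta> * real (doublings h) - (exp \<theta> - 1) * clock h"
        by (simp add: algebra_simps)
    qed auto
    also have "\<dots> \<le> exp (- (\<theta> * \<epsilon> * real k))"
      by (rule prob_doublings_le)
    also have "\<dots> = exp (- (\<theta> * \<epsilon>)) ^ k"
      by (simp add: exp_of_nat_mult[symmetric] mult.commute)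
    finally show "prob {\<omega> \<in> space M. P k (history \<nu> (2 ^ k) \<omega>)} \<le> exp (- (\<theta> * \<epsilon>)) ^ k" .
  qed (use assms \<theta> in \<open>auto intro!: sets_history summable_geometric\<close>)
  then show ?thesis by (simp add: P_def not_less)
qed

text \<open>Only a positive linear rate matters, to populate relative height 0. The tail bound with
  \<open>\<theta> = -1\<close> gives about \<open>D >= T / 2 - k / 10\<close>, and
  \<open>T + D >= 2 * k / 3\<close>, so small \<open>D\<close> would force a large clock and hence
  large \<open>D\<close>.\<close>

lemma AE_doublings_lower:
  "AE \<omega> in M. eventually (\<lambda>k. real k / 10 \<le> real (doublings (history \<nu> (2 ^ k) \<omega>))) sequentially"
proof -
  define P where "P k h \<longleftrightarrow> real (doublings h) < clock h / 2 - real k / 10" for k h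
  have e: "1 / 2 \<le> 1 - exp (- 1 :: real)"
    using exp_ge_add_one_self[of 1] by (simp add: exp_minus field_simps)
  have "AE \<omega> in M. eventually (\<lambda>k. \<not> P k (history \<nu> (2 ^ k) \<omega>)) sequentially"
  proof (rule AE_eventually_not)
    fix k
    have "prob {\<omega> \<in> space M. P k (history \<nu> (2 ^ k) \<omega>)} = measure_pmf.prob (hist_law (2 ^ k)) {h. P k h}"
      by (rule prob_history)
    also have "\<dots> \<le> measure_pmf.prob (hist_law (2 ^ k))
        {h. real k / 10 \<le> - 1 * real (doublings h) - (exp (- 1) - 1) * clock h}"
    proof (intro measure_pmf.finite_measure_mono Collect_mono impI)
      fix h assume "P k h"
      moreover have "1 / 2 * clock h \<le> (1 - exp (- 1)) * clock h"
        using e clock_nonneg by (intro mult_right_mono)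
      ultimately show "real k / 10 \<le> - 1 * real (doublings h) - (exp (- 1) - 1) * clock h"
        by (simp add: P_def algebra_simps)
    qed auto
    also have "\<dots> \<le> exp (- (real k / 10))"
      by (rule prob_doublings_le)
    also have "\<dots> = exp (- (1 / 10)) ^ k"
      by (simp add: exp_of_nat_mult[symmetric])
    finally show "prob {\<omega> \<in> space M. P k (history \<nu> (2 ^ k) \<omega>)} \<le> exp (- (1 / 10)) ^ k" .
  qed (auto intro!: sets_history summable_geometric)
  then show ?thesis
  proof (rule AE_mp, intro AE_I2 impI)
    fix \<omega>
    assume "eventually (\<lambda>k. \<not> P k (history \<nu> (2 ^ k) \<omega>)) sequentially"
    then show "eventually (\<lambda>k. real k / 10 \<le> real (doublings (history \<nu> (2 ^ k) \<omega>))) sequentially"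
    proof eventually_elim
      case (elim k)
      define h where "h = history \<nu> (2 ^ k) \<omega>"
      have "real k * ln 2 \<le> clock h + ln 2 * real (doublings h)"
        by (rule ln_length_le) (simp add: h_def)
      also have "\<dots> \<le> clock h + 1 * real (doublings h)"
        using ln_2_less_1 by (intro add_left_mono mult_right_mono) auto
      finally have "real k * ln 2 \<le> clock h + real (doublings h)" by simp
      moreover have "real k * (2 / 3) \<le> real k * ln 2"
        using ln2_ge_two_thirds by (intro mult_left_mono) auto
      moreover have "clock h / 2 - real k / 10 \<le> real (doublings h)"
        using elim by (simp add: P_def h_def)
      ultimately show ?case by (simp add: h_def)
    qed
  qed
qed

text \<open>The union bound has \<open>(2 ^ k + 1) ^ 3\<close> terms; the threshold
  \<open>k ^ 2\<close> on the counts makes each term small enough to beat this exponential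
  number.\<close>

lemma AE_not_stalled:
  fixes a q :: real
  assumes q: "0 < q" "q < a"
  shows "AE \<omega> in M. eventually (\<lambda>k. \<forall>n d j. n + d \<le> 2 ^ k \<longrightarrow> j \<le> 2 ^ k \<longrightarrow>
           \<not> stalled a q ((real k)\<^sup>2) d j (history \<nu> (n + d) \<omega>)) sequentially"
proof -
  \<comment> \<open>Since \<open>1 - exp (- \<theta>) >= \<theta> / (1 + \<theta>)\<close>,
    positivity of \<open>x\<close> follows from \<open>q * (1 + \<theta>) < a\<close>; this choice
    makes the left side the midpoint of \<open>q\<close> and \<open>a\<close>.\<close>
  define \<theta> where "\<theta> = (a - q) / (2 * q)"
  have \<theta>: "0 < \<theta>" using q by (simp add: \<theta>_def)
  define x where "x = (1 - exp (- \<theta>)) * a - \<theta> * q"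
  have "\<theta> / (1 + \<theta>) \<le> 1 - exp (- \<theta>)"
    using exp_ge_add_one_self[of \<theta>] \<theta> by (simp add: exp_minus field_simps)
  then have "\<theta> / (1 + \<theta>) * a \<le> (1 - exp (- \<theta>)) * a"
    using q by (intro mult_right_mono) auto
  moreover have "q * (1 + \<theta>) < a"
    using q by (simp add: \<theta>_def field_simps)
  then have "\<theta> * (q * (1 + \<theta>)) < \<theta> * a"
    using \<theta> by (rule mult_strict_left_mono)
  then have "\<theta> * q < \<theta> / (1 + \<theta>) * a"
    using \<theta> by (simp add: less_divide_eq algebra_simps)
  ultimately have x: "0 < x" by (simp add: x_def)
  define I :: "nat \<Rightarrow> (nat \<times> nat \<times> nat) set" where "I k = {..2 ^ k} \<times> {..2 ^ k} \<times> {..2 ^ k}" for k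
  define B where "B k = (\<lambda>(n, d, j). {\<omega> \<in> space M. stalled a q ((real k)\<^sup>2) d j (history \<nu> (n + d) \<omega>)})" for k
  have [measurable]: "B k i \<in> sets M" for k i
    by (auto simp: B_def split: prod.split intro!: sets_history)
  have [simp]: "finite (I k)" for k by (simp add: I_def)
  have "AE \<omega> in M. eventually (\<lambda>k. \<not> \<omega> \<in> (\<Union>i\<in>I k. B k i)) sequentially"
  proof (rule AE_eventually_not)
    have sp: "{\<omega> \<in> space M. \<omega> \<in> (\<Union>i\<in>I k. B k i)} = (\<Union>i\<in>I k. B k i)" for k
      by (auto simp: B_def)
    show "{\<omega> \<in> space M. \<omega> \<in> (\<Union>i\<in>I k. B k i)} \<in> sets M" for k
      unfolding sp by measurable
    show "prob {\<omega> \<in> space M. \<omega> \<in> (\<Union>i\<in>I k. B k i)} \<le> (2 ^ k + 1) ^ 3 * exp (- (x * (real k)\<^sup>2))" for k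
    proof -
      have "prob (\<Union>i\<in>I k. B k i) \<le> (\<Sum>i\<in>I k. prob (B k i))"
        by (intro finite_measure_subadditive_finite) auto
      also have "\<dots> \<le> (\<Sum>i\<in>I k. exp (- (x * (real k)\<^sup>2)))"
        using \<theta> x by (intro sum_mono)
          (auto simp: B_def prob_history x_def intro!: prob_stalled_le[where \<theta> = \<theta>])
      also have "\<dots> = (2 ^ k + 1) ^ 3 * exp (- (x * (real k)\<^sup>2))"
        by (simp add: I_def power3_eq_cube algebra_simps)
      finally show ?thesis unfolding sp .
    qed
    show "summable (\<lambda>k. (2 ^ k + 1) ^ 3 * exp (- (x * (real k)\<^sup>2)))"
    proof (rule summable_comparison_test_ev)
      have "eventually (\<lambda>k. (2 ^ k + 1) ^ 3 * exp (- (x * (real k)\<^sup>2)) \<le> exp (- real k)) sequentially"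
        using x by real_asymp
      then show "eventually (\<lambda>k. norm ((2 ^ k + 1) ^ 3 * exp (- (x * (real k)\<^sup>2))) \<le> exp (- 1) ^ k) sequentially"
        by eventually_elim (simp add: exp_of_nat_mult[symmetric])
    qed (simp add: summable_geometric)
  qed
  then show ?thesis
  proof (rule AE_mp, intro AE_I2 impI)
    fix \<omega>
    assume "\<omega> \<in> space M" "eventually (\<lambda>k. \<not> \<omega> \<in> (\<Union>i\<in>I k. B k i)) sequentially"
    then show "eventually (\<lambda>k. \<forall>n d j. n + d \<le> 2 ^ k \<longrightarrow> j \<le> 2 ^ k \<longrightarrow>
           \<not> stalled a q ((real k)\<^sup>2) d j (history \<nu> (n + d) \<omega>)) sequentially"
      by (elim eventually_mono) (auto simp: I_def B_def)
  qed
qed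

text \<open>The front runs from time \<open>2 ^ (k div s)\<close> to \<open>2 ^ k\<close>, starting
  with \<open>k ^ 3\<close> nodes at relative height 0. For large \<open>s\<close> the clock time
  spent before the start is a small multiple of \<open>k\<close>.\<close>

lemma AE_tree_height_ge:
  fixes c \<epsilon> :: real
  assumes c: "0 < c" "c < exp 1" and \<epsilon>: "0 < \<epsilon>"
  shows "AE \<omega> in M. eventually (\<lambda>k.
           real (doublings (history \<nu> (2 ^ k) \<omega>)) + c * clock (history \<nu> (2 ^ k) \<omega>) - \<epsilon> * real k
             \<le> real (tree_height (hist_tree (history \<nu> (2 ^ k) \<omega>)))) sequentially"
proof -
  obtain c' where c': "c < c'" "c' < exp 1" using c dense by blast
  obtain m R q where mR: "1 \<le> m" "0 < R" "0 < q" "q \<le> 1" "1 \<le> q ^ m * real (R choose m)" "real m = c' * real R * q"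
    using ex_euler_parameters[of c'] c c' by (metis less_trans)
  \<comment> \<open>At a cost of \<open>a'\<close> per stage the speed drops from \<open>c'\<close>
    to \<open>c\<close>. The gap between \<open>q\<close> and \<open>a'\<close> is split by
    \<open>a\<close>: \<open>q < a\<close> makes stalling unlikely, \<open>a < a'\<close> pays for
    overshoot.\<close>
  define a' where "a' = q * c' / c"
  define a where "a = (q + a') / 2"
  have a': "q < a'" using c c' mR by (simp add: a'_def field_simps)
  then have a: "q < a" "a < a'" by (simp_all add: a_def)
  have rate: "real m / (a' * real R) = c"
    using mR c c' by (simp add: a'_def)
  \<comment> \<open>Makes \<open>c / s\<close> at most \<open>\<epsilon> / 2\<close>, which bounds
    the clock lost before the start.\<close>
  define s where "s = nat \<lceil>2 * c / \<epsilon>\<rceil> + 1"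
  have s: "2 * c / \<epsilon> \<le> real s" "0 < s" unfolding s_def by linarith+
  have q_pow: "eventually (\<lambda>k. 1 / q ^ m \<le> real k) sequentially"
    by real_asymp
  have div_top: "filterlim (\<lambda>k. k div s) sequentially sequentially"
    using s by (intro filterlim_at_top_div_const_nat)
  have "eventually (\<lambda>n. 1 / (2 ^ n + 1) \<le> a' - a) sequentially"
    using a by real_asymp
  \<comment> \<open>Bounds the advance of the clock by a single pick after time
    \<open>2 ^ (k div s)\<close>.\<close>
  then have small: "eventually (\<lambda>k. 1 / (2 ^ (k div s) + 1) \<le> a' - a) sequentially"
    using div_top by (rule eventually_compose_filterlim)
  \<comment> \<open>The right side, at \<open>n = k div s\<close>, is a lower bound for the starting
    population, to be compared with \<open>k ^ 3\<close> through
    \<open>k <= s * (k div s + 1)\<close>.\<close>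
  have "eventually (\<lambda>n. (real s * (real n + 1)) ^ 3 \<le> 2 powr (real n / 10)) sequentially"
    using s by real_asymp
  then have "eventually (\<lambda>k. (real s * (real (k div s) + 1)) ^ 3 \<le> 2 powr (real (k div s) / 10)) sequentially"
    using div_top by (rule eventually_compose_filterlim)
  then have cube: "eventually (\<lambda>k. real k ^ 3 \<le> 2 powr (real (k div s) / 10)) sequentially"
  proof eventually_elim
    case (elim k)
    have "k \<le> s * (k div s + 1)"
      using dividend_less_div_times[of s k] s by (simp add: algebra_simps)
    then have "real k \<le> real (s * (k div s + 1))"
      by (rule of_nat_mono)
    then have "real k ^ 3 \<le> (real s * (real (k div s) + 1)) ^ 3"
      by (intro power_mono) (auto simp: algebra_simps)
    then show ?case using elim by (rule order_trans)
  qed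
  \<comment> \<open>The term \<open>c\<close> comes from the 1 in \<open>clock_le_ln\<close>;
    \<open>2 * m\<close> pays for rounding in \<open>i\<close> and in
    \<open>i div R\<close>.\<close>
  have const: "eventually (\<lambda>k. c + 2 * real m \<le> \<epsilon> / 2 * real k) sequentially"
    using \<epsilon> by real_asymp
  show ?thesis
    using AE_not_stalled[OF mR(3) a(1)] AE_doublings_lower
  proof eventually_elim
    case (elim \<omega>)
    define T where "T n = clock (history \<nu> n \<omega>)" for n
    define A where "A n j = real (card (level (history \<nu> n \<omega>) j))" for n j
    have T_mono: "mono T"
      unfolding T_def using clock_mono_drop[of 1 "history \<nu> (Suc _) \<omega>"]
      by (intro incseq_SucI) simp
    have A_mono: "A n j \<le> A n' j" if "n \<le> n'" for n n' j
      using card_level_drop[of "n' - n" "history \<nu> n' \<omega>" j] drop_history[of "n' - n" \<nu> n \<omega>] that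
      by (simp add: A_def)
    have D: "eventually (\<lambda>k. real (k div s) / 10 \<le> real (doublings (history \<nu> (2 ^ (k div s)) \<omega>))) sequentially"
      using elim(2) div_top by (rule eventually_compose_filterlim)
    show ?case
      using elim(1) D q_pow small cube const eventually_ge_at_top[of s]
    proof eventually_elim
      case (elim k)
      define N n\<^sub>0 :: nat where "N = 2 ^ k" and "n\<^sub>0 = 2 ^ (k div s)"
      define i where "i = nat \<lfloor>(T N - T n\<^sub>0) / a'\<rfloor>"
      have n0N: "n\<^sub>0 \<le> N" unfolding N_def n\<^sub>0_def by (intro power_increasing) auto
      have k: "1 \<le> k" using elim(7) s by linarith
      have "0 \<le> (T N - T n\<^sub>0) / a'"
        using monoD[OF T_mono n0N] a' mR by simp
      then have i: "real i \<le> (T N - T n\<^sub>0) / a'" "(T N - T n\<^sub>0) / a' - 1 \<le> real i"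
        unfolding i_def by linarith+
      have "real k ^ 3 \<le> A N (m * (i div R))"
      proof (rule front_advance[where T = T and A = A and L = "(real k)\<^sup>2" and a = a and a' = a' and q = q and n\<^sub>0 = n\<^sub>0])
        show "A n (Suc j) + q * A n j \<le> A n' (Suc j)"
          if "n \<le> n'" "n' \<le> N" "j \<le> N" "(real k)\<^sup>2 \<le> A n j" "a \<le> T n' - T n" for n n' j
        proof -
          have "\<not> stalled a q ((real k)\<^sup>2) (n' - n) j (history \<nu> (n + (n' - n)) \<omega>)"
            using that by (intro elim(1)[rule_format]) (simp_all add: N_def)
          then show ?thesis
            using that drop_history[of "n' - n" \<nu> n \<omega>] by (simp add: stalled_def A_def T_def)
        qed
        show "T (Suc n) \<le> T n + (a' - a)" if "n\<^sub>0 \<le> n" for n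
        proof -
          have "n\<^sub>0 + 1 \<le> card (hist_tree (history \<nu> n \<omega>))"
            using card_hist_tree_ge[of "history \<nu> n \<omega>"] that by simp
          then have "real (n\<^sub>0 + 1) \<le> real (card (hist_tree (history \<nu> n \<omega>)))"
            by linarith
          then have "1 / real (card (hist_tree (history \<nu> n \<omega>))) \<le> 1 / real (n\<^sub>0 + 1)"
            by (intro divide_left_mono) auto
          also have "\<dots> \<le> a' - a" using elim(4) by (simp add: n\<^sub>0_def add.commute)
          finally show ?thesis by (simp add: T_def)
        qed
        show "real k ^ 3 \<le> A n\<^sub>0 0"
        proof -
          define D where "D = doublings (history \<nu> n\<^sub>0 \<omega>)"
          have D: "real (k div s) / 10 \<le> real D" using elim(2) by (simp add: D_def n\<^sub>0_def)
          moreover have "0 < k div s" using elim(7) s by (simp add: div_greater_zero_iff)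
          ultimately have "0 < D" by (cases "D = 0") auto
          have "2 powr (real (k div s) / 10) \<le> 2 powr real D"
            using D by simp
          also have "\<dots> = real (2 ^ D)" by (simp add: powr_realpow)
          also have "\<dots> \<le> A n\<^sub>0 0"
            unfolding A_def of_nat_le_iff D_def by (rule level_zero_ge) (use \<open>0 < D\<close> in \<open>simp add: D_def\<close>)
          finally show ?thesis using elim(5) by simp
        qed
        \<comment> \<open>The surplus factor \<open>k\<close> over the stalling threshold pays for
          the thinning \<open>q ^ m\<close> within a block.\<close>
        show "(real k)\<^sup>2 \<le> real k ^ 3 * q ^ m"
        proof -
          have "1 \<le> real k * q ^ m" using elim(3) mR by (simp add: divide_le_eq)
          then have "(real k)\<^sup>2 * 1 \<le> (real k)\<^sup>2 * (real k * q ^ m)"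
            by (intro mult_left_mono) auto
          then show ?thesis by (simp add: power2_eq_square power3_eq_cube mult_ac)
        qed
        show "T n\<^sub>0 + real i * a' \<le> T N"
          using i(1) a' mR by (simp add: le_divide_eq)
      qed (use T_mono A_mono n0N k a a' mR in \<open>auto simp: A_def\<close>)
      moreover have "0 < real k ^ 3" using k by simp
      ultimately have "0 < A N (m * (i div R))" by linarith
      then have "level (history \<nu> N \<omega>) (m * (i div R)) \<noteq> {}"
        by (auto simp: A_def card_gt_0_iff)
      from tree_height_ge_level[OF this]
      have H: "real (doublings (history \<nu> N \<omega>)) + real (m * (i div R)) \<le> real (tree_height (hist_tree (history \<nu> N \<omega>)))"
        by linarith
      have Tn0: "c * T n\<^sub>0 \<le> c + \<epsilon> / 2 * real k"
      proof -
        have "T n\<^sub>0 \<le> 1 + ln (real n\<^sub>0)"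
          using clock_le_ln[of "history \<nu> n\<^sub>0 \<omega>"] by (simp add: T_def n\<^sub>0_def flip: length_0_conv)
        also have "ln (real n\<^sub>0) \<le> real (k div s)"
          using ln_2_less_1 mult_left_mono[of "ln 2" 1 "real (k div s)"] by (simp add: n\<^sub>0_def ln_realpow)
        also have "\<dots> \<le> real k / real s"
          by (rule of_nat_div_le_of_nat)
        finally have "c * T n\<^sub>0 \<le> c * (1 + real k / real s)"
          using c by (intro mult_left_mono) auto
        also have "\<dots> = c + c / real s * real k"
          by (simp add: algebra_simps)
        also have "\<dots> \<le> c + \<epsilon> / 2 * real k"
          using s \<epsilon> by (intro add_left_mono mult_right_mono) (auto simp: field_simps)
        finally show ?thesis .
      qed
      have "c * (T N - T n\<^sub>0) - 2 * real m \<le> real m * (real i / real R - 1)"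
      proof -
        have "c * (T N - T n\<^sub>0) - 2 * real m = real m * ((T N - T n\<^sub>0) / a' / real R) - real m - real m"
          by (simp add: rate[symmetric])
        also have "\<dots> \<le> real m * ((real i + 1) / real R) - real m - real m"
          using i(2) mR by (intro diff_right_mono mult_left_mono divide_right_mono) auto
        also have "\<dots> \<le> real m * (real i / real R + 1) - real m - real m"
          using mR by (intro diff_right_mono mult_left_mono) (auto simp: add_divide_distrib)
        finally show ?thesis by (simp add: algebra_simps)
      qed
      also have "\<dots> \<le> real m * real (i div R)"
      proof (intro mult_left_mono)
        have "real i = real R * real (i div R) + real (i mod R)"
          by (metis mult_div_mod_eq of_nat_add of_nat_mult)
        moreover have "real (i mod R) \<le> real R" using mR by simp
        ultimately have "real i \<le> (real (i div R) + 1) * real R" by (simp add: algebra_simps)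
        then have "real i / real R \<le> real (i div R) + 1" using mR by (simp add: divide_le_eq)
        then show "real i / real R - 1 \<le> real (i div R)" by simp
      qed simp
      finally show ?case
        using H Tn0 elim(6) by (simp add: N_def[symmetric] T_def[symmetric] algebra_simps)
    qed
  qed
qed

text \<open>Multiplying \<open>k * ln 2 <= T + D * ln 2\<close> by \<open>\<gamma>\<close> leaves
  the surplus \<open>s * D\<close> beyond \<open>\<gamma> * T + D\<close>. As \<open>s >= 0\<close>,
  the upper bound on \<open>D\<close> may be inserted there, and \<open>\<gamma> + s = exp 1\<close>
  recovers the front estimate.\<close>

lemma AE_tree_height_powers:
  fixes \<epsilon> :: real
  assumes \<epsilon>: "0 < \<epsilon>"
  shows "AE \<omega> in M. eventually (\<lambda>k. (height_const * ln 2 - \<epsilon>) * real k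
           \<le> real (tree_height (hist_tree (history \<nu> (2 ^ k) \<omega>)))) sequentially"
proof -
  \<comment> \<open>The factor 12 collects \<open>9 + 1 + 2\<close>: the error in the bound on
    \<open>D\<close>, the error of the front estimate, and the deficit
    \<open>\<delta> * T <= 2 * \<delta> * k\<close>.\<close>
  define \<delta> where "\<delta> = min 1 (\<epsilon> / 12)"
  have \<delta>: "0 < \<delta>" "\<delta> \<le> 1" "12 * \<delta> \<le> \<epsilon>" using \<epsilon> by (auto simp: \<delta>_def)
  have e: "2 \<le> exp (1::real)" using exp_ge_add_one_self[of 1] by simp
  have e3: "exp (1::real) \<le> 3" by (rule exp_le)
  define \<gamma> where "\<gamma> = height_const"
  define s where "s = \<gamma> * ln 2 - 1"
  have ln2: "2 / 3 \<le> ln (2::real)" "ln 2 < (1::real)" by (rule ln2_ge_two_thirds ln_2_less_1)+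
  have \<gamma>_eq: "\<gamma> * (1 + ln 2) = 1 + exp 1" using ln2 by (simp add: \<gamma>_def)
  have \<gamma>0: "0 \<le> \<gamma>" using ln2 by (simp add: \<gamma>_def add_nonneg_nonneg)
  have s: "0 \<le> s" "s \<le> 3"
  proof -
    have "1 * 1 \<le> exp 1 * ln (2::real)"
    proof -
      have "3 / 2 * (2 / 3) \<le> exp 1 * ln (2::real)" using e ln2 by (intro mult_mono) auto
      then show ?thesis by simp
    qed
    then have "1 * (1 + ln 2) \<le> (1 + exp 1) * ln (2::real)" by (simp add: algebra_simps)
    also have "\<dots> = \<gamma> * ln 2 * (1 + ln 2)" by (simp add: \<gamma>_eq[symmetric])
    finally show "0 \<le> s" using ln2 by (simp add: s_def)
    have "\<gamma> + \<gamma> * ln 2 \<le> 4" using \<gamma>_eq e3 by (simp add: algebra_simps)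
    then show "s \<le> 3" using \<gamma>0 by (simp add: s_def)
  qed
  have large: "eventually (\<lambda>k. 1 \<le> real k) sequentially" by real_asymp
  have c: "0 < exp 1 - \<delta>" "exp 1 - \<delta> < exp 1" using e \<delta> by auto
  show ?thesis
    using AE_doublings_upper[OF \<delta>(1)] AE_tree_height_ge[OF c \<delta>(1)]
  proof eventually_elim
    case (elim \<omega>)
    from elim(1,2) large show ?case
    proof eventually_elim
      case (elim k)
      define h where "h = history \<nu> (2 ^ k) \<omega>"
      define T where "T = clock h"
      define D where "D = real (doublings h)"
      define H where "H = real (tree_height (hist_tree h))"
      have T: "T \<le> 1 + real k"
      proof -
        have "T \<le> 1 + ln (real (2 ^ k))"
          using clock_le_ln[of h] by (simp add: T_def h_def flip: length_0_conv)
        also have "ln (real (2 ^ k)) \<le> real k"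
          using ln2 mult_left_mono[of "ln 2" 1 "real k"] by (simp add: ln_realpow)
        finally show ?thesis by simp
      qed
      have "real k * ln 2 \<le> T + ln 2 * D"
        unfolding T_def D_def by (rule ln_length_le) (simp add: h_def)
      then have "\<gamma> * (real k * ln 2) \<le> \<gamma> * (T + ln 2 * D)"
        using \<gamma>0 by (rule mult_left_mono)
      also have "\<dots> = \<gamma> * T + D + s * D"
        by (simp add: s_def algebra_simps)
      also have "\<dots> \<le> \<gamma> * T + D + s * ((1 + \<delta>) * T + \<delta> * real k)"
        using elim(1) s by (intro add_left_mono mult_left_mono) (auto simp: D_def T_def h_def)
      also have "\<dots> = exp 1 * T + D + s * \<delta> * (T + real k)"
      proof -
        have "(\<gamma> + s) * T = exp 1 * T" using \<gamma>_eq by (simp add: s_def algebra_simps)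
        then show ?thesis by (simp add: algebra_simps)
      qed
      also have "\<dots> \<le> exp 1 * T + D + 3 * \<delta> * (3 * real k)"
      proof (intro add_left_mono mult_mono)
        show "T + real k \<le> 3 * real k" using T elim(3) by simp
        show "0 \<le> T + real k" using clock_nonneg[of h] by (simp add: T_def)
      qed (use s \<delta> in auto)
      finally have "\<gamma> * (real k * ln 2) \<le> exp 1 * T + D + 9 * \<delta> * real k" by simp
      moreover have "D + (exp 1 - \<delta>) * T - \<delta> * real k \<le> H"
        using elim(2) by (simp add: D_def T_def H_def h_def)
      moreover have "\<delta> * T \<le> \<delta> * (2 * real k)" using T elim(3) \<delta> by (intro mult_left_mono) auto
      moreover have "12 * \<delta> * real k \<le> \<epsilon> * real k" using \<delta> by (intro mult_right_mono) auto
      ultimately have "(\<gamma> * ln 2 - \<epsilon>) * real k \<le> H"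
        by (simp add: algebra_simps)
      then show ?case
        by (simp only: H_def h_def \<gamma>_def)
    qed
  qed
qed

section \<open>From powers of two to all times\<close>

lemma tree_height_history_mono: "n \<le> n' \<Longrightarrow>
  tree_height (hist_tree (history \<nu> n \<omega>)) \<le> tree_height (hist_tree (history \<nu> n' \<omega>))"
proof (induction n' rule: dec_induct)
  case (step n')
  then show ?case using tree_height_Cons[of "history \<nu> n' \<omega>" "\<nu> n' \<omega>"] by simp
qed simp

lemma AE_tree_height_lower:
  fixes \<epsilon> :: real
  assumes \<epsilon>: "0 < \<epsilon>"
  shows "AE \<omega> in M. eventually (\<lambda>n. (height_const - \<epsilon>) * ln (real n)
           \<le> real (tree_height (hist_tree (history \<nu> n \<omega>)))) sequentially"
proof -
  define \<gamma> where "\<gamma> = height_const"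
  have ln2: "0 < ln (2::real)" by simp
  \<comment> \<open>The first bound keeps \<open>\<mu>\<close> nonnegative, the second keeps
    \<open>\<mu> / ln 2\<close> above \<open>\<gamma> - \<epsilon> / 2\<close>. The other half of
    \<open>\<epsilon>\<close> absorbs the loss \<open>\<mu>\<close> from rounding \<open>n\<close>
    down to a power of two.\<close>
  define \<delta> where "\<delta> = min (\<gamma> * ln 2) (\<epsilon> * ln 2 / 2)"
  have \<gamma>0: "0 < \<gamma>" unfolding \<gamma>_def by (intro divide_pos_pos add_pos_pos) auto
  have \<delta>: "0 < \<delta>" "\<delta> \<le> \<gamma> * ln 2" "\<delta> \<le> \<epsilon> * ln 2 / 2" using \<epsilon> \<gamma>0 by (auto simp: \<delta>_def)
  define \<mu> where "\<mu> = \<gamma> * ln 2 - \<delta>"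
  have large: "eventually (\<lambda>n. \<mu> \<le> \<epsilon> / 2 * ln (real n)) sequentially"
    using \<epsilon> by real_asymp
  show ?thesis
    using AE_tree_height_powers[OF \<delta>(1)]
  proof eventually_elim
    case (elim \<omega>)
    have "eventually (\<lambda>n. \<mu> * real (floor_log n)
           \<le> real (tree_height (hist_tree (history \<nu> (2 ^ floor_log n) \<omega>)))) sequentially"
      using eventually_compose_filterlim[OF elim filterlim_floor_log] by (simp add: \<mu>_def \<gamma>_def)
    from this large eventually_gt_at_top[of 0] show ?case
    proof eventually_elim
      case (elim n)
      define k where "k = floor_log n"
      have k: "2 ^ k \<le> n" "n < 2 ^ Suc k"
        using elim(3) floor_log_exp2_le[of n] floor_log_exp2_gt[of n] by (simp_all add: k_def)
      have "real n < real (2 ^ Suc k)"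
        using k(2) by (rule of_nat_less_iff[THEN iffD2])
      then have "ln (real n) \<le> ln (2 ^ Suc k)"
        using elim(3) by (subst ln_le_cancel_iff) auto
      also have "\<dots> = (real k + 1) * ln 2" by (simp add: ln_realpow algebra_simps ln_mult)
      finally have "\<mu> / ln 2 * ln (real n) \<le> \<mu> / ln 2 * ((real k + 1) * ln 2)"
        using \<delta> by (intro mult_left_mono) (auto simp: \<mu>_def)
      also have "\<dots> = \<mu> * real k + \<mu>" by (simp add: algebra_simps)
      also have "\<dots> \<le> real (tree_height (hist_tree (history \<nu> n \<omega>))) + \<epsilon> / 2 * ln (real n)"
        using elim(1,2) tree_height_history_mono[OF k(1), of \<omega>] by (simp add: k_def)
      finally have "\<mu> / ln 2 * ln (real n) - \<epsilon> / 2 * ln (real n)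
          \<le> real (tree_height (hist_tree (history \<nu> n \<omega>)))" by simp
      moreover have "(\<gamma> - \<epsilon> / 2) * ln (real n) \<le> \<mu> / ln 2 * ln (real n)"
        using \<delta> elim(3) by (intro mult_right_mono) (auto simp: \<mu>_def field_simps)
      ultimately show ?case by (simp add: \<gamma>_def algebra_simps)
    qed
  qed
qed

end

theorem proposition1p5:
  fixes M :: "'a measure"
    and \<tau> :: "nat \<Rightarrow> 'a \<Rightarrow> nat list set"
    and \<nu> :: "nat \<Rightarrow> 'a \<Rightarrow> nat list"
  assumes "rrt_doubling M \<tau> \<nu>"
  shows "\<exists>R :: nat \<Rightarrow> 'a \<Rightarrow> real.
           (\<forall>n. R n \<in> borel_measurable M) \<and>
           (AE \<omega> in M. (\<lambda>n. R n \<omega> / ln (real n)) \<longlonglongrightarrow> 0) \<and>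
           (AE \<omega> in M. \<forall>n\<ge>1. real (tree_height (\<tau> n \<omega>))
                                \<ge> (1 + exp 1) / (1 + ln 2) * ln (real n) + R n \<omega>)"
proof -
  interpret rrt_doubling M \<tau> \<nu> by (rule assms)
  define H where "H n \<omega> = real (tree_height (hist_tree (history \<nu> n \<omega>)))" for n \<omega>
  \<comment> \<open>The truncation at 0 makes the height bound hold surely and \<open>R\<close>
    nonpositive, so only a lower bound on \<open>R n \<omega> / ln (real n)\<close> remains to be
    shown.\<close>
  define R where "R n \<omega> = min 0 (H n \<omega> - height_const * ln (real n))" for n \<omega>
  have H_meas: "H n \<in> borel_measurable M" for n
    unfolding H_def by (rule measurable_compose[OF measurable_history]) simp
  have "AE \<omega> in M. (\<lambda>n. R n \<omega> / ln (real n)) \<longlonglongrightarrow> 0"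
  proof -
    \<comment> \<open>Countably many tolerances, so that one null set serves them all.\<close>
    have "AE \<omega> in M. \<forall>i. eventually (\<lambda>n. (height_const - 1 / real (Suc i)) * ln (real n) \<le> H n \<omega>) sequentially"
      unfolding H_def AE_all_countable by (intro allI AE_tree_height_lower) simp
    then show ?thesis
    proof eventually_elim
      case (elim \<omega>)
      show ?case
      proof (rule tendstoI)
        fix e :: real assume "0 < e"
        then obtain i where i: "1 / real (Suc i) < e" using nat_approx_posE by metis
        from elim[rule_format, of i] eventually_gt_at_top[of 1]
        show "eventually (\<lambda>n. dist (R n \<omega> / ln (real n)) 0 < e) sequentially"
        proof eventually_elim
          case (elim n)
          have l: "0 < ln (real n)" using elim(2) by simp
          have "- (1 / real (Suc i)) * ln (real n) \<le> R n \<omega>"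
            using elim(1) l by (simp add: R_def algebra_simps)
          then have "- (1 / real (Suc i)) \<le> R n \<omega> / ln (real n)"
            using l by (simp add: le_divide_eq)
          moreover have "R n \<omega> / ln (real n) \<le> 0"
            using l by (simp add: R_def divide_le_0_iff)
          ultimately show ?case using i by (simp add: dist_real_def)
        qed
      qed
    qed
  qed
  moreover have "AE \<omega> in M. \<forall>n\<ge>1. real (tree_height (\<tau> n \<omega>)) \<ge> height_const * ln (real n) + R n \<omega>"
  proof (intro AE_I2 allI impI)
    fix n \<omega>
    assume "\<omega> \<in> space M"
    then have "real (tree_height (\<tau> n \<omega>)) = H n \<omega>"
      by (simp add: tau_eq H_def)
    then show "height_const * ln (real n) + R n \<omega> \<le> real (tree_height (\<tau> n \<omega>))"
      unfolding R_def by linarith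
  qed
  moreover have "R n \<in> borel_measurable M" for n
    unfolding R_def using H_meas by measurable
  ultimately show ?thesis by blast
qed

end
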